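(* Let $K=\{p_1,p_2,\dots,p_n\}$ be a finite set in a normed plane $\mathbb{M}^2=(\mathbb{R}^2,\|\cdot\|)$ having diameter $1$. Let $\widehat{p_ip_j}$ denote a minimal circular arc of radius $1$ meeting $p_i$ and $p_j$. Let $H$ be the set of all balls of radius $1$ whose boundary contains a circular arc meeting points from $K$ (i.e. an arc of the sphere having two distinct points of $K$ as endpoints). Then $$\operatorname{bh}(K)=\bigcap_{K\subset B(x,1)\in H}B(x,1)=\operatorname{conv}\Big(\bigcup_{i,j=1}^n\widehat{p_ip_j}\Big),$$ where the union is over all minimal circular arcs of radius $1$ meeting two points of $K$.
   Context: $B(x,1)=\{y:\|y-x\|\le1\}$ is the ball and $S(x,1)=\{y:\|y-x\|=1\}$ the sphere (circle) with center $x$ and radius $1$. For a set $K$ of diameter $1$, the ball hull is $\operatorname{bh}(K)=\bigcap_{K\subset B(x,1)}B(x,1)$, the intersection of all balls of radius $\operatorname{diam}(K)=1$ that contain $K$. For distinct points $p,q$ of a circle $S(x,1)$, the minimal circular arc of $B(x,1)$ meeting $p$ and $q$ is the piece of $S(x,1)$ with endpoints $p$ and $q$ which lies in the closed half-plane bounded by the line through $p,q$ and not containing the center $x$; if $p$ and $q$ are opposite in $S(x,1)$, both half-circles with endpoints $p,q$ are minimal circular arcs. Such an arc, for any $x$ with $p,q\in S(x,1)$, is called a minimal circular arc of radius $1$ meeting $p$ and $q$. (For $i=j$ the arc $\widehat{p_ip_j}$ is understood as the point $p_i$.) *)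

theory Defs
  imports "HOL-Analysis.Analysis"
begin

definition ball_hull :: "'a::real_normed_vector set \<Rightarrow> 'a set" where
  "ball_hull K = \<Inter>{cball x 1 | x. K \<subseteq> cball x 1}"

text \<open>
  \<open>A\<close> is a piece of the unit circle about \<open>x\<close> with endpoints \<open>p\<close> and \<open>q\<close>. Being the image of
  an injective path forces \<open>p \<noteq> q\<close>.
\<close>

definition circular_arc :: "'a::real_normed_vector \<Rightarrow> 'a \<Rightarrow> 'a \<Rightarrow> 'a set \<Rightarrow> bool" where
  "circular_arc x p q A \<longleftrightarrow>
     (\<exists>g. arc g \<and> path_image g = A \<and> pathstart g = p \<and> pathfinish g = q) \<and> A \<subseteq> sphere x 1"

definition closed_half_plane :: "'a::real_normed_vector set \<Rightarrow> 'a set \<Rightarrow> bool" where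
  "closed_half_plane L H \<longleftrightarrow>
     (\<exists>f c. linear f \<and> f \<noteq> (\<lambda>_. 0) \<and> L = {y. f y = (c::real)} \<and> H = {y. f y \<le> c})"

text \<open>
  If the circle contains a segment of the line through \<open>p\<close> and \<open>q\<close>, its intersection with the
  half-plane may extend beyond \<open>p\<close> and \<open>q\<close>; the arc is then only the segment from \<open>p\<close> to \<open>q\<close>,
  which is why the endpoints are part of the condition. The last disjunct is the case of opposite
  points, where the center lies on the line and both half-circles are admitted.
\<close>

definition minimal_arc_of_ball :: "'a::real_normed_vector \<Rightarrow> 'a \<Rightarrow> 'a \<Rightarrow> 'a set \<Rightarrow> bool" where
  "minimal_arc_of_ball x p q A \<longleftrightarrow>
     circular_arc x p q A \<and>
     (\<exists>H. closed_half_plane (affine hull {p, q}) H \<and> A \<subseteq> H \<and> (x \<notin> H \<or> x = midpoint p q))"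

definition minimal_arc :: "'a::real_normed_vector \<Rightarrow> 'a \<Rightarrow> 'a set \<Rightarrow> bool" where
  "minimal_arc p q A \<longleftrightarrow> (if p = q then A = {p} else (\<exists>x. minimal_arc_of_ball x p q A))"

definition arc_balls :: "'a::real_normed_vector set \<Rightarrow> 'a set set" where
  "arc_balls K = {cball x 1 | x. \<exists>p\<in>K. \<exists>q\<in>K. p \<noteq> q \<and> (\<exists>A. circular_arc x p q A)}"

end

theory Submission
  imports Defs
begin

text \<open>
  Let \<open>C\<close> be the convex set of centers of unit balls containing \<open>K\<close>. Minimal arcs lie in the ball
  hull by an elementary case distinction in coordinates with respect to the two endpoints.

  For the ball hull to lie in the hull of the arcs, let \<open>f\<close> be a linear functional with maximum \<open>M\<close>
  on the unit ball, attained at \<open>e\<close>, and let \<open>x\<close> minimize \<open>f\<close> on \<open>C\<close>. The ball hull lies in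
  \<open>f \<le> f x + M\<close>. As \<open>x\<close> cannot be moved downwards within \<open>C\<close>, either some point of \<open>K\<close> reaches this
  level, or there are points of \<open>K\<close> on the circle about \<open>x\<close> on both sides of \<open>x + e\<close>; in that case
  \<open>x + e\<close> is on the minimal arc between them.

  To discard the balls with fewer than two points of \<open>K\<close> on their boundary, let \<open>x \<in> C\<close> have maximal
  distance to a point \<open>v\<close> with \<open>\<parallel>x - v\<parallel> > 1\<close>; it lies on the circle about some \<open>p \<in> K\<close>. If no center
  with two points of \<open>K\<close> at distance 1 excluded \<open>v\<close>, a connectedness argument would put into \<open>C\<close> every
  center on that circle excluding \<open>v\<close>. Among these are a highest and a lowest point of the circle with
  respect to a functional \<open>g\<close> vanishing on \<open>v - p\<close>, and every other \<open>q \<in> K\<close> would satisfy both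
  \<open>g q > g p\<close> and \<open>g q < g p\<close>.
\<close>

subsection \<open>Norm inequalities in a cone\<close>

lemma norm_le_on_line:
  fixes x e :: "'a::real_normed_vector"
  assumes "a \<le> t" "t \<le> b" "norm (x + a *\<^sub>R e) \<le> c" "norm (x + b *\<^sub>R e) \<le> c"
  shows "norm (x + t *\<^sub>R e) \<le> c"
proof (cases "a = b")
  case True
  then show ?thesis using assms by simp
next
  case False
  then have ab: "b - a > 0" using assms by simp
  have "(b - a) *\<^sub>R (x + t *\<^sub>R e) = (b - t) *\<^sub>R (x + a *\<^sub>R e) + (t - a) *\<^sub>R (x + b *\<^sub>R e)"
    by (simp add: algebra_simps)
  then have "(b - a) * norm (x + t *\<^sub>R e) \<le> (b - t) * norm (x + a *\<^sub>R e) + (t - a) * norm (x + b *\<^sub>R e)"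
    using norm_triangle_ineq[of "(b - t) *\<^sub>R (x + a *\<^sub>R e)" "(t - a) *\<^sub>R (x + b *\<^sub>R e)"] assms ab
    by (metis (no_types, opaque_lifting) abs_of_nonneg diff_ge_0_iff_ge less_eq_real_def norm_scaleR)
  also have "\<dots> \<le> (b - t) * c + (t - a) * c"
    using assms by (intro add_mono mult_left_mono) auto
  also have "\<dots> = (b - a) * c" by (simp add: algebra_simps)
  finally show ?thesis using ab by simp
qed

lemma norm_comb2_le:
  fixes x y :: "'a::real_normed_vector"
  assumes "0 \<le> a" "0 \<le> b" "norm x \<le> c" "norm y \<le> d"
  shows "norm (a *\<^sub>R x + b *\<^sub>R y) \<le> a * c + b * d"
proof -
  have "norm (a *\<^sub>R x + b *\<^sub>R y) \<le> a * norm x + b * norm y"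
    using norm_triangle_ineq[of "a *\<^sub>R x" "b *\<^sub>R y"] assms by simp
  also have "\<dots> \<le> a * c + b * d"
    using assms by (intro add_mono mult_left_mono) auto
  finally show ?thesis .
qed

text \<open>By convexity along the line in direction q it suffices to compare the norms of a p and a
  p + d q. Here the bound on \<open>norm (p - q)\<close> enters: (a + d) a p is the combination of p
  - q and a p + d q with weights d a and a.\<close>

lemma norm_cone_mono_right:
  fixes p q :: "'a::real_normed_vector"
  assumes "norm p = 1" "norm q = 1" "norm (p - q) \<le> 1" "0 \<le> a" "0 \<le> b" "b \<le> d"
  shows "norm (a *\<^sub>R p + b *\<^sub>R q) \<le> norm (a *\<^sub>R p + d *\<^sub>R q)"
proof (cases "a = 0")
  case True
  then show ?thesis using assms by simp
next
  case False
  then have a: "a > 0" using assms by simp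
  have "(a + d) *\<^sub>R (a *\<^sub>R p) = (d * a) *\<^sub>R (p - q) + a *\<^sub>R (a *\<^sub>R p + d *\<^sub>R q)"
    by (simp add: algebra_simps)
  then have "norm ((a + d) *\<^sub>R (a *\<^sub>R p)) \<le> d * a * 1 + a * norm (a *\<^sub>R p + d *\<^sub>R q)"
    using norm_comb2_le[of "d * a" a "p - q" 1 "a *\<^sub>R p + d *\<^sub>R q"] assms by simp
  moreover have "norm ((a + d) *\<^sub>R (a *\<^sub>R p)) = (a + d) * a" using assms by simp
  ultimately have "a * a \<le> a * norm (a *\<^sub>R p + d *\<^sub>R q)" by (simp add: algebra_simps)
  then have "norm (a *\<^sub>R p + 0 *\<^sub>R q) \<le> norm (a *\<^sub>R p + d *\<^sub>R q)" using a assms by simp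
  then show ?thesis using norm_le_on_line[of 0 b d "a *\<^sub>R p" q] assms by simp
qed

lemma norm_cone_mono:
  fixes p q :: "'a::real_normed_vector"
  assumes "norm p = 1" "norm q = 1" "norm (p - q) \<le> 1" "0 \<le> a" "a \<le> c" "0 \<le> b" "b \<le> d"
  shows "norm (a *\<^sub>R p + b *\<^sub>R q) \<le> norm (c *\<^sub>R p + d *\<^sub>R q)"
proof -
  have "norm (a *\<^sub>R p + b *\<^sub>R q) \<le> norm (a *\<^sub>R p + d *\<^sub>R q)"
    using assms by (intro norm_cone_mono_right) auto
  also have "\<dots> \<le> norm (c *\<^sub>R p + d *\<^sub>R q)"
    using norm_cone_mono_right[of q p d a c] assms by (simp add: norm_minus_commute add.commute)
  finally show ?thesis .
qed

text \<open>With z the point of the arc and y the other center, z - y is a convex combination of z,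
  p - y and q - y, with weights proportional to \<alpha> + \<beta> - 1, l - a and b - l for l =
  \<alpha> b + \<beta> a. The inequalities a \<le> l \<le> b that make the weights nonnegative come
  from bounding multiples of p.\<close>

lemma wedge_point_in_ball_opposite_signs:
  fixes p q :: "'a::real_normed_vector"
  assumes p: "norm p = 1" and q: "norm q = 1"
    and al: "0 \<le> \<alpha>" and be: "0 \<le> \<beta>" and sum: "1 \<le> \<alpha> + \<beta>" and z: "norm (\<alpha> *\<^sub>R p + \<beta> *\<^sub>R q) \<le> 1"
    and a: "0 < a" and b: "0 < b"
    and py: "norm (p - (b *\<^sub>R q - a *\<^sub>R p)) \<le> 1" and qy: "norm (q - (b *\<^sub>R q - a *\<^sub>R p)) \<le> 1"
  shows "norm (\<alpha> *\<^sub>R p + \<beta> *\<^sub>R q - (b *\<^sub>R q - a *\<^sub>R p)) \<le> 1"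
proof -
  define y where "y = b *\<^sub>R q - a *\<^sub>R p"
  define z where "z = \<alpha> *\<^sub>R p + \<beta> *\<^sub>R q"
  have P: "norm (p - y) \<le> 1" and Q: "norm (q - y) \<le> 1" and Z: "norm z \<le> 1"
    using assms by (auto simp: y_def z_def)
  have "(1 + a) *\<^sub>R p = 1 *\<^sub>R (p - y) + b *\<^sub>R q" by (simp add: y_def algebra_simps)
  then have "norm ((1 + a) *\<^sub>R p) \<le> 1 * 1 + b * 1"
    using norm_comb2_le[of 1 b "p - y" 1 q 1] P b q by simp
  then have ab: "a \<le> b" using p a by simp
  have "(\<beta> + \<beta> * a + \<alpha> * b) *\<^sub>R p = \<beta> *\<^sub>R (p - y) + b *\<^sub>R z"
    by (simp add: y_def z_def algebra_simps)
  then have "norm ((\<beta> + \<beta> * a + \<alpha> * b) *\<^sub>R p) \<le> \<beta> * 1 + b * 1"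
    using norm_comb2_le[of \<beta> b "p - y" 1 z 1] P Z b be by simp
  then have le: "\<beta> * a + \<alpha> * b \<le> b" using p a b al be by simp
  have "norm (z - y) \<le> 1"
  \<comment> \<open>If a = b, then \<alpha> + \<beta> = 1 is forced and all three weights vanish; z
    - y is then directly a convex combination of p - y and q - y.\<close>
  proof (cases "a = b")
    case True
    then have "(\<alpha> + \<beta>) * b \<le> 1 * b" using le by (simp add: algebra_simps)
    then have "\<alpha> + \<beta> = 1" using b sum by simp
    then have 1: "\<beta> = 1 - \<alpha>" by simp
    have "z - y = \<alpha> *\<^sub>R (p - y) + \<beta> *\<^sub>R (q - y)"
      unfolding z_def 1 by (simp add: algebra_simps)
    then show ?thesis using norm_comb2_le[of \<alpha> \<beta> "p - y" 1 "q - y" 1] P Q al be 1 by simp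
  next
    case False
    define D where "D = b - a"
    define l where "l = \<alpha> * b + \<beta> * a"
    have D: "D > 0" using False ab by (simp add: D_def)
    have "(\<alpha> + \<beta>) * a \<le> l" unfolding l_def using ab al by (simp add: algebra_simps mult_left_mono)
    moreover have "1 * a \<le> (\<alpha> + \<beta>) * a" using sum a by (intro mult_right_mono) auto
    ultimately have l: "a \<le> l" "l \<le> b" using le by (auto simp: l_def)
    have eq: "(D + \<alpha> + \<beta> - 1) *\<^sub>R (z - y) =
        (\<alpha> + \<beta> - 1) *\<^sub>R z + 1 *\<^sub>R ((l - a) *\<^sub>R (p - y) + (b - l) *\<^sub>R (q - y))"
      unfolding D_def l_def z_def y_def by (simp add: algebra_simps)
    have "norm ((l - a) *\<^sub>R (p - y) + (b - l) *\<^sub>R (q - y)) \<le> (l - a) * 1 + (b - l) * 1"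
      using l P Q by (intro norm_comb2_le) auto
    then have "norm ((l - a) *\<^sub>R (p - y) + (b - l) *\<^sub>R (q - y)) \<le> D" by (simp add: D_def)
    then have "norm ((D + \<alpha> + \<beta> - 1) *\<^sub>R (z - y)) \<le> (\<alpha> + \<beta> - 1) * 1 + 1 * D"
      unfolding eq using sum Z by (intro norm_comb2_le) auto
    moreover have "norm ((D + \<alpha> + \<beta> - 1) *\<^sub>R (z - y)) = (D + \<alpha> + \<beta> - 1) * norm (z - y)"
      using D sum by simp
    ultimately have "(D + \<alpha> + \<beta> - 1) * norm (z - y) \<le> (D + \<alpha> + \<beta> - 1) * 1" by (simp add: algebra_simps)
    then show ?thesis using D sum by (subst (asm) mult_le_cancel_left_pos) auto
  qed
  then show ?thesis by (simp add: y_def z_def)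
qed

text \<open>This is the core of the inclusion of minimal arcs in the ball hull, with the center of
  the arc at the origin and y = a p + b q the center of another unit ball containing p and q. The
  signs of a and b tell in which of the four sectors cut out by the lines along p and q the center y
  lies.\<close>

lemma wedge_point_in_ball:
  fixes p q :: "'a::real_normed_vector"
  assumes p: "norm p = 1" and q: "norm q = 1" and pq: "norm (p - q) \<le> 1"
    and al: "0 \<le> \<alpha>" and be: "0 \<le> \<beta>" and z: "norm (\<alpha> *\<^sub>R p + \<beta> *\<^sub>R q) = 1"
    and py: "norm (p - (a *\<^sub>R p + b *\<^sub>R q)) \<le> 1" and qy: "norm (q - (a *\<^sub>R p + b *\<^sub>R q)) \<le> 1"
  shows "norm (\<alpha> *\<^sub>R p + \<beta> *\<^sub>R q - (a *\<^sub>R p + b *\<^sub>R q)) \<le> 1"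
proof -
  note mono = norm_cone_mono[OF p q pq]
  have al1: "\<alpha> \<le> 1" using mono[of \<alpha> \<alpha> 0 \<beta>] al be z p by simp
  have be1: "\<beta> \<le> 1" using mono[of 0 \<alpha> \<beta> \<beta>] al be z q by simp
  have sum: "1 \<le> \<alpha> + \<beta>" using norm_comb2_le[of \<alpha> \<beta> p 1 q 1] al be z p q by simp
  define y where "y = a *\<^sub>R p + b *\<^sub>R q"
  have P: "norm (p - y) \<le> 1" and Q: "norm (q - y) \<le> 1" using py qy by (auto simp: y_def)
  \<comment> \<open>By convexity the chord from p to q lies in the ball about y. The chord points
    sharing a coordinate with z serve as comparison points below.\<close>
  have seg: "norm ((\<theta> - a) *\<^sub>R p + (1 - \<theta> - b) *\<^sub>R q) \<le> 1" if "0 \<le> \<theta>" "\<theta> \<le> 1" for \<theta>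
  proof -
    have "(\<theta> - a) *\<^sub>R p + (1 - \<theta> - b) *\<^sub>R q = \<theta> *\<^sub>R (p - y) + (1 - \<theta>) *\<^sub>R (q - y)"
      by (simp add: y_def algebra_simps)
    then show ?thesis using norm_comb2_le[of \<theta> "1 - \<theta>" "p - y" 1 "q - y" 1] that P Q by simp
  qed
  have eq: "\<alpha> *\<^sub>R p + \<beta> *\<^sub>R q - (a *\<^sub>R p + b *\<^sub>R q) = (\<alpha> - a) *\<^sub>R p + (\<beta> - b) *\<^sub>R q"
    by (simp add: algebra_simps)
  consider "a \<le> 0" "b \<le> 0" | "a < 0" "0 < b" | "0 < a" "b < 0" | "0 \<le> a" "0 \<le> b" by linarith
  then show ?thesis
  proof cases
    case 1
    \<comment> \<open>Monotonicity in the cone bounds the distances of y from p and q below by 1 - a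
      and 1 - b, so y must be the origin.\<close>
    have "1 - a \<le> norm ((1 - a) *\<^sub>R p + (- b) *\<^sub>R q)"
      using mono[of "1 - a" "1 - a" 0 "- b"] 1 p by simp
    also have "(1 - a) *\<^sub>R p + (- b) *\<^sub>R q = p - y" by (simp add: y_def algebra_simps)
    finally have "a = 0" using 1 P by simp
    have "1 - b \<le> norm ((- a) *\<^sub>R p + (1 - b) *\<^sub>R q)"
      using mono[of 0 "- a" "1 - b" "1 - b"] 1 q by simp
    also have "(- a) *\<^sub>R p + (1 - b) *\<^sub>R q = q - y" by (simp add: y_def algebra_simps)
    finally have "b = 0" using 1 Q by simp
    then show ?thesis using z \<open>a = 0\<close> by simp
  next
    case 2
    then show ?thesis
      using wedge_point_in_ball_opposite_signs[of p q \<alpha> \<beta> "- a" b] assms sum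
      by (simp add: algebra_simps)
  next
    case 3
    then show ?thesis
      using wedge_point_in_ball_opposite_signs[of q p \<beta> \<alpha> "- b" a] assms sum
      by (simp add: algebra_simps)
  next
    case 4
    \<comment> \<open>If the coordinates of y and z are ordered alike, z - y or y - z is dominated
      in the cone by z or by y minus a chord point. Otherwise z - y lies on a segment parallel to p
      or q, running from a chord point minus y to a multiple of q or p of norm at most 1.\<close>
    consider "a \<le> \<alpha>" "b \<le> \<beta>" | "\<alpha> \<le> a" "\<beta> \<le> b" | "\<alpha> \<le> a" "b \<le> \<beta>" | "a \<le> \<alpha>" "\<beta> \<le> b" by linarith
    then show ?thesis
    proof cases
      case 1
      then show ?thesis unfolding eq using mono[of "\<alpha> - a" \<alpha> "\<beta> - b" \<beta>] 4 z by simp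
    next
      case 2
      have "norm ((a - \<alpha>) *\<^sub>R p + (b - \<beta>) *\<^sub>R q) \<le> norm ((a - \<alpha>) *\<^sub>R p + (b - (1 - \<alpha>)) *\<^sub>R q)"
        using 2 sum by (intro mono) auto
      also have "\<dots> = norm (- ((\<alpha> - a) *\<^sub>R p + (1 - \<alpha> - b) *\<^sub>R q))"
        by (rule arg_cong[where f = norm]) (simp add: algebra_simps)
      also have "\<dots> \<le> 1" using seg[of \<alpha>] al al1 by (simp only: norm_minus_cancel)
      finally show ?thesis unfolding eq
        by (subst norm_minus_cancel[symmetric]) (simp add: algebra_simps)
    next
      case 3
      have "norm ((\<beta> - b) *\<^sub>R q + (\<alpha> - a) *\<^sub>R p) \<le> 1"
      proof (rule norm_le_on_line[of "1 - \<beta> - a" _ 0])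
        show "norm ((\<beta> - b) *\<^sub>R q + (1 - \<beta> - a) *\<^sub>R p) \<le> 1"
          using seg[of "1 - \<beta>"] be be1 by (simp add: add.commute)
      qed (use 3 4 sum be1 q in auto)
      then show ?thesis unfolding eq by (simp add: add.commute)
    next
      case c4: 4
      show ?thesis unfolding eq
      proof (rule norm_le_on_line[of "1 - \<alpha> - b" _ 0])
        show "norm ((\<alpha> - a) *\<^sub>R p + (1 - \<alpha> - b) *\<^sub>R q) \<le> 1"
          using seg[of \<alpha>] al al1 by simp
      qed (use c4 4 sum al1 p in auto)
    qed
  qed
qed

text \<open>Moving a center along the circle towards e keeps a point excluded; this later joins
  excluding centers to one another. If z + s e were in the unit ball, then \<alpha> \<ge> 1, and on
  the line through z in direction e the norm would be at most \<alpha> at the parameters -\<beta>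
  and s. The point \<alpha> (x + s e) lies on this line, and convexity, or the triangle inequality
  beyond s, bounds its norm by \<alpha>, against \<open>out\<close>.\<close>

lemma norm_gt_one_towards_apex:
  fixes x e :: "'a::real_normed_vector"
  assumes x: "norm x = 1" and e: "norm e = 1" and s: "0 < s" and out: "1 < norm (x + s *\<^sub>R e)"
    and al: "0 \<le> \<alpha>" and be: "0 \<le> \<beta>" and z: "norm (\<alpha> *\<^sub>R x + \<beta> *\<^sub>R e) = 1"
  shows "1 < norm (\<alpha> *\<^sub>R x + \<beta> *\<^sub>R e + s *\<^sub>R e)"
proof (rule ccontr)
  define z where "z = \<alpha> *\<^sub>R x + \<beta> *\<^sub>R e"
  assume "\<not> ?thesis"
  then have zs: "norm (z + s *\<^sub>R e) \<le> 1" by (simp add: z_def)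
  have z1: "norm z = 1" using z by (simp add: z_def)
  have "(s + \<beta>) *\<^sub>R z = (s * \<alpha>) *\<^sub>R x + \<beta> *\<^sub>R (z + s *\<^sub>R e)"
    by (simp add: z_def algebra_simps)
  then have "norm ((s + \<beta>) *\<^sub>R z) \<le> s * \<alpha> * 1 + \<beta> * 1"
    using norm_comb2_le[of "s * \<alpha>" \<beta> x 1 "z + s *\<^sub>R e" 1] s al be x zs by simp
  then have "s * 1 \<le> s * \<alpha>" using z1 s be by simp
  then have al1: "1 \<le> \<alpha>" using s by (simp only: mult_le_cancel_left_pos)
  have "\<alpha> *\<^sub>R x = 1 *\<^sub>R z + \<beta> *\<^sub>R (- e)" by (simp add: z_def)
  then have "norm (\<alpha> *\<^sub>R x) \<le> 1 * 1 + \<beta> * 1"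
    using norm_comb2_le[of 1 \<beta> z 1 "- e" 1] be z1 e by simp
  then have be1: "\<alpha> - 1 \<le> \<beta>" using x al by simp
  have "s *\<^sub>R e = 1 *\<^sub>R (z + s *\<^sub>R e) + 1 *\<^sub>R (- z)" by simp
  then have "norm (s *\<^sub>R e) \<le> 1 * 1 + 1 * 1"
    using norm_comb2_le[of 1 1 "z + s *\<^sub>R e" 1 "- z" 1] zs z1 by simp
  then have s2: "s \<le> 2" using s e by simp
  define t where "t = \<alpha> * s - \<beta>"
  have eq: "\<alpha> *\<^sub>R (x + s *\<^sub>R e) = z + t *\<^sub>R e" by (simp add: z_def t_def algebra_simps)
  have m: "norm (z + (- \<beta>) *\<^sub>R e) \<le> \<alpha>" using x al by (simp add: z_def)
  have "norm (z + t *\<^sub>R e) \<le> \<alpha>"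
  proof (cases "t \<le> s")
    case True
    show ?thesis
      by (rule norm_le_on_line[of "- \<beta>" t s]) (use m zs al1 True al s in \<open>auto simp: t_def\<close>)
  next
    case False
    have "(\<alpha> - 1) * s \<le> (\<alpha> - 1) * 2" using al1 s2 by (intro mult_left_mono) auto
    then have "t - s \<le> \<alpha> - 1" using be1 by (simp add: t_def algebra_simps)
    have "z + t *\<^sub>R e = 1 *\<^sub>R (z + s *\<^sub>R e) + (t - s) *\<^sub>R e" by (simp add: algebra_simps)
    moreover have "norm (1 *\<^sub>R (z + s *\<^sub>R e) + (t - s) *\<^sub>R e) \<le> 1 * 1 + (t - s) * 1"
      using zs e False by (intro norm_comb2_le) auto
    ultimately have "norm (z + t *\<^sub>R e) \<le> 1 * 1 + (t - s) * 1" by (simp only:)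
    then show ?thesis using \<open>t - s \<le> \<alpha> - 1\<close> by simp
  qed
  then have "\<alpha> * norm (x + s *\<^sub>R e) \<le> \<alpha> * 1" using al eq by (metis abs_of_nonneg mult.right_neutral norm_scaleR)
  then have "norm (x + s *\<^sub>R e) \<le> 1" using al1 by (simp add: mult_le_cancel_left)
  then show False using out by simp
qed

subsection \<open>Two-dimensional normed spaces\<close>

lemma independent_pairI:
  fixes p q :: "'a::real_vector"
  assumes "\<And>a b. a *\<^sub>R p + b *\<^sub>R q = 0 \<Longrightarrow> a = 0 \<and> b = 0"
  shows "p \<noteq> q" "independent {p, q}"
proof -
  show pq: "p \<noteq> q" using assms[of 1 "-1"] by auto
  have "q \<noteq> 0" using assms[of 0 1] by auto
  moreover have "p \<notin> span {q}"
  proof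
    assume "p \<in> span {q}"
    then obtain k where "p = k *\<^sub>R q" by (auto simp: span_singleton)
    then show False using assms[of 1 "- k"] by auto
  qed
  ultimately show "independent {p, q}" using pq by (simp add: independent_insert)
qed

lemma unit_vectors_independent:
  fixes p q :: "'a::real_normed_vector"
  assumes "norm p = 1" "norm q = 1" "p \<noteq> q" "p \<noteq> - q" "a *\<^sub>R p + b *\<^sub>R q = 0"
  shows "a = 0 \<and> b = 0"
proof (rule ccontr)
  assume ab: "\<not> ?thesis"
  have eq: "a *\<^sub>R p = - (b *\<^sub>R q)" using assms(5) by (simp add: eq_neg_iff_add_eq_0)
  have "\<bar>a\<bar> = norm (a *\<^sub>R p)" using assms(1) by simp
  also have "\<dots> = \<bar>b\<bar>" unfolding eq using assms(2) by simp
  finally have "a = b \<or> a = - b" by (simp add: abs_eq_iff)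
  then show False
  proof
    assume 1: "a = b"
    then have "a *\<^sub>R (p + q) = 0" using eq by (simp add: algebra_simps)
    then show False using 1 ab assms(4) by (simp add: eq_neg_iff_add_eq_0)
  next
    assume 1: "a = - b"
    then have "b *\<^sub>R (p - q) = 0" using eq by (simp add: algebra_simps)
    then show False using 1 ab assms(3) by simp
  qed
qed

lemma not_antipodal:
  fixes p q x :: "'a::real_normed_vector"
  assumes "norm (p - x) = 1" "norm (p - q) < 2"
  shows "p - x \<noteq> - (q - x)"
proof
  assume "p - x = - (q - x)"
  then have "p - q = 2 *\<^sub>R (p - x)" by (simp add: algebra_simps scaleR_2)
  then have "norm (p - q) = 2 * norm (p - x)" by simp
  then show False using assms by simp
qed

text \<open>The plane is given only by its dimension and a norm. This isomorphism with
  \<open>real \<times> real\<close> transports compactness, continuity of functionals and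
  separation. Its inverse is bounded because \<open>norm (h z)\<close> has a positive minimum c on
  the Euclidean unit circle.\<close>

lemma plane_coordinates:
  assumes dim: "dim (UNIV :: 'a::real_normed_vector set) = 2"
  obtains h :: "real \<times> real \<Rightarrow> 'a::real_normed_vector" and j where
    "bounded_linear h" "bounded_linear j" "\<And>y. h (j y) = y" "\<And>z. j (h z) = z"
proof -
  obtain B :: "'a set" where B: "independent B" "UNIV \<subseteq> span B" "card B = 2"
    using basis_exists[of "UNIV :: 'a set"] dim by metis
  then obtain u w where uw: "B = {u, w}" "u \<noteq> w" by (metis card_2_iff)
  define h where "h z = fst z *\<^sub>R u + snd z *\<^sub>R w" for z :: "real \<times> real"
  have w: "w \<noteq> 0" "u \<notin> span {w}"
    using B(1) uw by (simp_all add: independent_insert)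
  have lin: "linear h"
    by (rule linearI) (simp_all add: h_def algebra_simps)
  have inj: "inj h"
  proof (subst linear_injective_0[OF lin], intro allI impI)
    fix z assume z: "h z = 0"
    have "fst z = 0"
    proof (rule ccontr)
      assume f: "fst z \<noteq> 0"
      have "u = (1 / fst z) *\<^sub>R (fst z *\<^sub>R u)" using f by simp
      also have "fst z *\<^sub>R u = - snd z *\<^sub>R w"
        using z by (simp add: h_def eq_neg_iff_add_eq_0)
      finally have "u \<in> span {w}" by (metis rangeI scaleR_scaleR span_singleton)
      then show False using w by simp
    qed
    then show "z = 0" using z w by (simp add: h_def prod_eq_iff)
  qed
  have surj: "surj h"
  proof
    show "UNIV \<subseteq> range h"
    proof
      fix y
      have "y \<in> span (insert u {w})" using B uw by auto
      then obtain k where "y - k *\<^sub>R u \<in> span {w}" by (auto simp: span_insert)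
      then obtain l where "y - k *\<^sub>R u = l *\<^sub>R w" by (auto simp: span_singleton)
      then have "y = h (k, l)" by (simp add: h_def algebra_simps)
      then show "y \<in> range h" by blast
    qed
  qed auto
  have hb: "bounded_linear h" using lin by (simp add: linear_conv_bounded_linear)
  have "compact (sphere (0 :: real \<times> real) 1)" "sphere (0 :: real \<times> real) 1 \<noteq> {}" by simp_all
  moreover have "continuous_on (sphere 0 1) (\<lambda>z. norm (h z))"
    by (intro continuous_on_norm linear_continuous_on hb)
  ultimately obtain z0 where z0: "z0 \<in> sphere 0 1" "\<And>z. z \<in> sphere 0 1 \<Longrightarrow> norm (h z0) \<le> norm (h z)"
    using continuous_attains_inf[of "sphere 0 1" "\<lambda>z. norm (h z)"] by blast
  define c where "c = norm (h z0)"
  have "h z0 \<noteq> 0" using z0(1) inj lin by (metis dist_self inj_eq linear_0 mem_sphere zero_neq_one)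
  then have c: "c > 0" by (simp add: c_def)
  have le: "c * norm z \<le> norm (h z)" for z
  proof (cases "z = 0")
    case False
    have "c \<le> norm (h ((1 / norm z) *\<^sub>R z))"
      unfolding c_def by (rule z0(2)) (use False in simp)
    also have "\<dots> = norm (h z) / norm z" by (simp add: linear_scale[OF lin])
    finally show ?thesis using False by (simp add: field_simps)
  qed simp
  define j where "j = inv h"
  have hj: "h (j y) = y" for y using surj by (simp add: j_def surj_f_inv_f)
  have jh: "j (h z) = z" for z using inj by (simp add: j_def)
  have "bounded_linear j"
  proof (rule bounded_linear_intro)
    show "j (x + y) = j x + j y" for x y
      by (metis hj jh lin linear_add)
    show "j (r *\<^sub>R x) = r *\<^sub>R j x" for r x
      by (metis hj jh lin linear_scale)
    show "norm (j x) \<le> norm x * (1 / c)" for x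
      using le[of "j x"] c by (simp add: hj field_simps)
  qed
  then show thesis using that hb hj jh by blast
qed

lemma plane_compact:
  fixes S :: "'a::real_normed_vector set"
  assumes dim: "dim (UNIV :: 'a set) = 2" and "closed S" "bounded S"
  shows "compact S"
proof -
  obtain h :: "real \<times> real \<Rightarrow> 'a" and j where hj: "bounded_linear h" "bounded_linear j"
    "\<And>y. h (j y) = y" "\<And>z. j (h z) = z" by (rule plane_coordinates[OF dim]) blast
  have eq: "j ` S = h -` S" using hj(3,4) by (auto simp: image_iff) metis
  have "closed (h -` S)"
    using hj(1) assms(2) by (intro closed_vimage) (auto simp: linear_continuous_on)
  moreover have "bounded (h -` S)"
    unfolding eq[symmetric] using assms(3) hj(2) by (rule bounded_linear_image)
  ultimately have "compact (h -` S)" by (simp add: compact_eq_bounded_closed)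
  then have "compact (h ` (h -` S))"
    using hj(1) by (intro compact_continuous_image) (auto simp: linear_continuous_on)
  moreover have "h ` (h -` S) = S" using hj(3) by (metis surj_image_vimage_eq surjI)
  ultimately show ?thesis by simp
qed

lemma plane_compact_sphere:
  fixes x :: "'a::real_normed_vector"
  assumes dim: "dim (UNIV :: 'a set) = 2"
  shows "compact (sphere x r)"
proof (rule plane_compact[OF dim])
  show "closed (sphere x r)" unfolding sphere_def
    by (intro closed_Collect_eq continuous_intros)
  show "bounded (sphere x r)"
    by (rule bounded_subset[OF bounded_cball[of x r]]) auto
qed

lemma plane_linear_bounded:
  fixes f :: "'a::real_normed_vector \<Rightarrow> real"
  assumes dim: "dim (UNIV :: 'a set) = 2" and "linear f"
  shows "bounded_linear f"
proof -
  obtain h :: "real \<times> real \<Rightarrow> 'a" and j where hj: "bounded_linear h" "bounded_linear j"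
    "\<And>y. h (j y) = y" "\<And>z. j (h z) = z" by (rule plane_coordinates[OF dim]) blast
  have "linear (f \<circ> h)" using assms(2) hj(1) by (simp add: linear_compose bounded_linear.linear)
  then have "bounded_linear (f \<circ> h)" by (simp add: linear_conv_bounded_linear)
  from bounded_linear_compose[OF this hj(2)] show ?thesis by (simp add: hj(3))
qed

lemma plane_span_pair:
  fixes p q y :: "'a::real_normed_vector"
  assumes dim: "dim (UNIV :: 'a set) = 2" and "p \<noteq> q" "independent {p, q}"
  obtains a b where "y = a *\<^sub>R p + b *\<^sub>R q"
proof -
  obtain B :: "'a set" where B: "independent B" "UNIV \<subseteq> span B" "card B = 2"
    using basis_exists[of "UNIV :: 'a set"] dim by metis
  have "y \<in> span {p, q}"
  proof (rule ccontr)
    assume y: "y \<notin> span {p, q}"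
    then have "y \<notin> {p, q}" using span_base by blast
    have "independent (insert y {p, q})" using y assms(3) by (subst independent_insert) simp
    then have "card (insert y {p, q}) \<le> card B"
      using B by (intro independent_span_bound[THEN conjunct2]) (auto intro: card_ge_0_finite)
    then show False using B(3) \<open>y \<notin> {p, q}\<close> assms(2) by simp
  qed
  then obtain k where "y - k *\<^sub>R p \<in> span {q}" by (auto simp: span_insert)
  then obtain l where "y - k *\<^sub>R p = l *\<^sub>R q" by (auto simp: span_singleton)
  then have "y = k *\<^sub>R p + l *\<^sub>R q" by (simp add: algebra_simps)
  then show thesis by (rule that)
qed

lemma plane_kernel_vector:
  fixes f :: "'a::real_normed_vector \<Rightarrow> real"
  assumes dim: "dim (UNIV :: 'a set) = 2" and f: "linear f" and e: "f e \<noteq> 0"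
  obtains k where "k \<noteq> 0" "f k = 0" "\<And>y. \<exists>\<tau>. y = (f y / f e) *\<^sub>R e + \<tau> *\<^sub>R k"
proof -
  obtain h :: "real \<times> real \<Rightarrow> 'a" and j where hj: "bounded_linear h" "bounded_linear j"
    "\<And>y. h (j y) = y" "\<And>z. j (h z) = z" by (rule plane_coordinates[OF dim]) blast
  have lin: "linear (\<lambda>z. f (h z))"
    using linear_compose[of h f] f hj(1) by (simp add: bounded_linear.linear o_def)
  \<comment> \<open>In coordinates this is the gradient of f turned by a right angle.\<close>
  define k where "k = h (f (h (0, 1)), - f (h (1, 0)))"
  have eq: "f (h (s, t)) = s * f (h (1, 0)) + t * f (h (0, 1))" for s t
    using linear_add[OF lin, of "s *\<^sub>R (1, 0)" "t *\<^sub>R (0, 1)"]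
      linear_scale[OF lin, of s "(1, 0)"] linear_scale[OF lin, of t "(0, 1)"] by simp
  have fk: "f k = 0" unfolding k_def by (subst eq) simp
  have k: "k \<noteq> 0"
  proof
    assume "k = 0"
    then have "(f (h (0, 1)), - f (h (1, 0))) = j 0" unfolding k_def by (metis hj(4))
    then have "f (h (0, 1)) = 0 \<and> f (h (1, 0)) = 0"
      using linear_0[OF bounded_linear.linear[OF hj(2)]] by (simp add: zero_prod_def)
    then have "f (h (j e)) = 0" using eq[of "fst (j e)" "snd (j e)"] by simp
    then show False using e hj(3) by simp
  qed
  have ind: "a = 0 \<and> b = 0" if "a *\<^sub>R e + b *\<^sub>R k = 0" for a b
  proof -
    have "f (a *\<^sub>R e + b *\<^sub>R k) = a * f e" using f fk by (simp add: linear_add linear_scale)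
    then show ?thesis using that e k f by (auto simp: linear_0)
  qed
  have "\<exists>\<tau>. y = (f y / f e) *\<^sub>R e + \<tau> *\<^sub>R k" for y
  proof -
    obtain a b where ab: "y = a *\<^sub>R e + b *\<^sub>R k"
      using plane_span_pair[OF dim independent_pairI[OF ind]] by metis
    then have "f y = a * f e" using f fk by (simp add: linear_add linear_scale)
    then show ?thesis using ab e by auto
  qed
  then show thesis using that k fk by blast
qed

lemma plane_annihilator:
  fixes v :: "'a::real_normed_vector"
  assumes dim: "dim (UNIV :: 'a set) = 2" and v: "v \<noteq> 0"
  obtains g :: "'a \<Rightarrow> real" and w where "linear g" "g v = 0" "g w \<noteq> 0"
proof -
  obtain h :: "real \<times> real \<Rightarrow> 'a" and j where hj: "bounded_linear h" "bounded_linear j"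
    "\<And>y. h (j y) = y" "\<And>z. j (h z) = z" by (rule plane_coordinates[OF dim]) blast
  have lin: "linear j" using hj(2) by (rule bounded_linear.linear)
  \<comment> \<open>The determinant of the coordinate vectors of y and v; it is nonzero at v turned
    by a right angle.\<close>
  define g where "g y = fst (j y) * snd (j v) - snd (j y) * fst (j v)" for y
  have "linear g"
    by (rule linearI) (simp_all add: g_def linear_add[OF lin] linear_scale[OF lin] algebra_simps)
  moreover have "g v = 0" by (simp add: g_def)
  moreover have "g (h (snd (j v), - fst (j v))) \<noteq> 0"
  proof
    assume "g (h (snd (j v), - fst (j v))) = 0"
    then have "snd (j v) * snd (j v) + fst (j v) * fst (j v) = 0" by (simp add: g_def hj(4))
    then have "j v = 0" by (simp add: sum_squares_eq_zero_iff prod_eq_iff)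
    then show False using v hj(3)[of v] linear_0[OF bounded_linear.linear[OF hj(1)]] by simp
  qed
  ultimately show thesis by (rule that)
qed

lemma plane_unit_ball_maximizer:
  fixes f :: "'a::real_normed_vector \<Rightarrow> real"
  assumes dim: "dim (UNIV :: 'a set) = 2" and f: "linear f" and w: "f w \<noteq> 0"
  obtains e where "norm e = 1" "0 < f e" "\<And>y. f y \<le> f e * norm y"
proof -
  have "compact (sphere (0::'a) 1)" using dim by (rule plane_compact_sphere)
  moreover have "(1 / norm w) *\<^sub>R w \<in> sphere 0 1" using w f by (auto simp: linear_0)
  then have "sphere (0::'a) 1 \<noteq> {}" by blast
  moreover have "continuous_on (sphere 0 1) f"
    by (intro linear_continuous_on plane_linear_bounded dim f)
  ultimately obtain e where e: "e \<in> sphere 0 1" "\<And>y. y \<in> sphere 0 1 \<Longrightarrow> f y \<le> f e"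
    using continuous_attains_sup[of "sphere 0 1" f] by blast
  have le: "f y \<le> f e * norm y" for y
  proof (cases "y = 0")
    case False
    then have "f ((1 / norm y) *\<^sub>R y) \<le> f e" by (intro e(2)) simp
    then show ?thesis using False f by (simp add: linear_scale field_simps)
  qed (use f in \<open>simp add: linear_0\<close>)
  have "f (- w) = - f w" using f by (rule linear_neg)
  then have "0 < f e * norm w" using le[of w] le[of "- w"] w by (cases "f w > 0") auto
  then have "0 < f e" by (simp add: zero_less_mult_iff)
  then show thesis using that e(1) le by simp
qed

text \<open>In Euclidean coordinates the convex hull of a compact set is closed, so a point outside
  it is strictly separated; the sign is reversed to put v on the upper side.\<close>

lemma plane_separation:
  fixes T :: "'a::real_normed_vector set"
  assumes dim: "dim (UNIV :: 'a set) = 2" and T: "compact T" and v: "v \<notin> convex hull T"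
  obtains f :: "'a \<Rightarrow> real" where "linear f" "\<And>t. t \<in> T \<Longrightarrow> f t < f v"
proof -
  obtain h :: "real \<times> real \<Rightarrow> 'a" and j where hj: "bounded_linear h" "bounded_linear j"
    "\<And>y. h (j y) = y" "\<And>z. j (h z) = z" by (rule plane_coordinates[OF dim]) blast
  have lin: "linear j" using hj(2) by (rule bounded_linear.linear)
  have "compact (j ` T)" using T hj(2) by (intro compact_continuous_image linear_continuous_on)
  then have "closed (convex hull (j ` T))" by (intro compact_imp_closed compact_convex_hull)
  moreover have "j v \<notin> convex hull (j ` T)"
    using v hj(3) by (auto simp: convex_hull_linear_image[OF lin, symmetric]) metis
  ultimately obtain a b where ab: "inner a (j v) < b" "\<And>x. x \<in> convex hull (j ` T) \<Longrightarrow> b < inner a x"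
    using separating_hyperplane_closed_point[OF convex_convex_hull, of "j ` T"] by blast
  show thesis
  proof
    show "linear (\<lambda>y. - inner a (j y))"
      by (rule linearI) (simp_all add: linear_add[OF lin] linear_scale[OF lin] inner_add_right)
    show "- inner a (j t) < - inner a (j v)" if "t \<in> T" for t
      using ab(1) ab(2)[of "j t"] that by (simp add: hull_inc)
  qed
qed

subsection \<open>Minimal arcs\<close>

text \<open>The part of the unit circle about x in the cone with apex x through p and q. It replaces
  paths and half-planes by explicit coordinates: it is itself a minimal arc unless p and q are
  opposite, and for endpoints on the circle at distance less than 2 it contains every minimal arc
  with center x.\<close>

definition wedge_arc :: "'a::real_normed_vector \<Rightarrow> 'a \<Rightarrow> 'a \<Rightarrow> 'a set" where
  "wedge_arc x p q = {z. norm (z - x) = 1 \<and>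
     (\<exists>\<alpha> \<beta>. 0 \<le> \<alpha> \<and> 0 \<le> \<beta> \<and> z - x = \<alpha> *\<^sub>R (p - x) + \<beta> *\<^sub>R (q - x))}"

lemma wedge_arcI:
  assumes "norm (z - x) = 1" "0 \<le> \<alpha>" "0 \<le> \<beta>" "z - x = \<alpha> *\<^sub>R (p - x) + \<beta> *\<^sub>R (q - x)"
  shows "z \<in> wedge_arc x p q"
  using assms by (auto simp: wedge_arc_def)

lemma wedge_arcE:
  assumes "z \<in> wedge_arc x p q"
  obtains \<alpha> \<beta> where "norm (z - x) = 1" "0 \<le> \<alpha>" "0 \<le> \<beta>"
    "z - x = \<alpha> *\<^sub>R (p - x) + \<beta> *\<^sub>R (q - x)"
  using assms by (auto simp: wedge_arc_def)

text \<open>The path is the radial projection of the chord from p to q onto the circle. Linear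
  independence of p - x and q - x keeps the chord away from the center and makes the projection
  injective.\<close>

lemma circular_arc_wedge_arc:
  fixes x :: "'a::real_normed_vector"
  assumes p: "norm (p - x) = 1" and q: "norm (q - x) = 1"
    and pq: "p \<noteq> q" and op: "p - x \<noteq> - (q - x)"
  shows "circular_arc x p q (wedge_arc x p q)"
proof -
  define P where "P = p - x"
  define Q where "Q = q - x"
  have ind: "a = 0 \<and> b = 0" if "a *\<^sub>R P + b *\<^sub>R Q = 0" for a b
    using unit_vectors_independent[of P Q a b] that p q pq op by (simp add: P_def Q_def)
  define w where "w t = (1 - t) *\<^sub>R P + t *\<^sub>R Q" for t :: real
  have w0: "w t \<noteq> 0" for t using ind[of "1 - t" t] by (auto simp: w_def)
  define g where "g t = x + w t /\<^sub>R norm (w t)" for t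
  have "path g" unfolding path_def g_def w_def
    by (intro continuous_intros) (use w0 in \<open>simp add: w_def\<close>)
  moreover have "inj_on g {0..1}"
  proof (rule inj_onI)
    fix s t assume eq: "g s = g t"
    define m n where "m = inverse (norm (w s))" and "n = inverse (norm (w t))"
    have "m > 0" using w0 by (simp add: m_def)
    have "m *\<^sub>R w s = n *\<^sub>R w t" using eq by (simp add: g_def m_def n_def)
    then have "(m * (1 - s) - n * (1 - t)) *\<^sub>R P + (m * s - n * t) *\<^sub>R Q = 0"
      by (simp add: w_def algebra_simps)
    from ind[OF this] have "m * (1 - s) = n * (1 - t)" "m * s = n * t" by auto
    then have "m = n" "m * s = n * t" by (auto simp: algebra_simps)
    then show "s = t" using \<open>m > 0\<close> by simp
  qed
  ultimately have "arc g" by (simp add: arc_def)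
  moreover have "path_image g = wedge_arc x p q"
  proof
    show "path_image g \<subseteq> wedge_arc x p q"
    proof
      fix z assume "z \<in> path_image g"
      then obtain t where t: "0 \<le> t" "t \<le> 1" "z = g t" by (auto simp: path_image_def)
      show "z \<in> wedge_arc x p q"
      proof (rule wedge_arcI)
        show "norm (z - x) = 1" using w0 t(3) by (simp add: g_def)
        show "z - x = (inverse (norm (w t)) * (1 - t)) *\<^sub>R (p - x) + (inverse (norm (w t)) * t) *\<^sub>R (q - x)"
          using t(3) by (simp add: g_def w_def P_def Q_def scaleR_add_right)
      qed (use t in auto)
    qed
    show "wedge_arc x p q \<subseteq> path_image g"
    proof
      fix z assume "z \<in> wedge_arc x p q"
      then obtain a b where z: "norm (z - x) = 1" "0 \<le> a" "0 \<le> b" "z - x = a *\<^sub>R P + b *\<^sub>R Q"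
        unfolding P_def Q_def by (rule wedge_arcE) blast
      define r where "r = a + b"
      have r: "r > 0" using z by (cases "a = 0 \<and> b = 0") (auto simp: r_def)
      \<comment> \<open>The parameter at which the ray from x through z meets the chord.\<close>
      define t where "t = b / r"
      have "1 - t = a / r" using r by (simp add: t_def r_def field_simps)
      then have wt: "w t = (z - x) /\<^sub>R r"
        by (simp add: w_def z(4) t_def scaleR_add_right divide_inverse mult.commute)
      then have "norm (w t) = inverse r" using z(1) r by simp
      then have "g t = z" using r by (simp add: g_def wt)
      moreover have "t \<in> {0..1}" using z r by (auto simp: t_def r_def)
      ultimately show "z \<in> path_image g" by (auto simp: path_image_def)
    qed
  qed
  moreover have "pathstart g = p" "pathfinish g = q"
    using p q by (simp_all add: pathstart_def pathfinish_def g_def w_def P_def Q_def)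
  moreover have "wedge_arc x p q \<subseteq> sphere x 1"
    by (auto simp: wedge_arc_def dist_norm norm_minus_commute)
  ultimately show ?thesis unfolding circular_arc_def by blast
qed

text \<open>A functional equal to -1 at p - x and q - x puts the line through p and q at level f x -
  1, strictly below the center. Points of the wedge arc are on or below that level because the
  triangle inequality gives a + b \<ge> 1.\<close>

lemma minimal_arc_wedge_arc:
  fixes x :: "'a::real_normed_vector"
  assumes dim: "dim (UNIV :: 'a set) = 2"
    and p: "norm (p - x) = 1" and q: "norm (q - x) = 1"
    and pq: "p \<noteq> q" and op: "p - x \<noteq> - (q - x)"
  shows "minimal_arc_of_ball x p q (wedge_arc x p q)"
proof -
  define P where "P = p - x"
  define Q where "Q = q - x"
  have "a = 0 \<and> b = 0" if "a *\<^sub>R P + b *\<^sub>R Q = 0" for a b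
    using unit_vectors_independent[of P Q a b] that p q pq op by (simp add: P_def Q_def)
  note ind = independent_pairI[OF this]
  obtain f :: "'a \<Rightarrow> real" where f: "linear f" "f P = - 1" "f Q = - 1"
    using linear_independent_extend[OF ind(2), where f = "\<lambda>_. - 1 :: real"] by auto
  have fx: "f z = f x - (a + b)" if "z - x = a *\<^sub>R P + b *\<^sub>R Q" for z a b
  proof -
    have "f z - f x = f (a *\<^sub>R P + b *\<^sub>R Q)" using that f(1) by (metis linear_diff)
    then show ?thesis using f by (simp add: linear_add linear_scale)
  qed
  have hull: "affine hull {p, q} = {y. f y = f x - 1}"
  proof
    show "affine hull {p, q} \<subseteq> {y. f y = f x - 1}"
    proof
      fix z assume "z \<in> affine hull {p, q}"
      then obtain a b where ab: "z = a *\<^sub>R p + b *\<^sub>R q" "a + b = 1" by (auto simp: affine_hull_2)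
      have "z - x = a *\<^sub>R p + b *\<^sub>R q - (a + b) *\<^sub>R x" using ab by simp
      also have "\<dots> = a *\<^sub>R P + b *\<^sub>R Q" by (simp add: P_def Q_def algebra_simps)
      finally show "z \<in> {y. f y = f x - 1}" using fx ab(2) by simp
    qed
    show "{y. f y = f x - 1} \<subseteq> affine hull {p, q}"
    proof
      fix z assume z: "z \<in> {y. f y = f x - 1}"
      obtain a b where ab: "z - x = a *\<^sub>R P + b *\<^sub>R Q" by (rule plane_span_pair[OF dim ind])
      then have 1: "a + b = 1" using fx z by auto
      have "z = a *\<^sub>R p + b *\<^sub>R q + (1 - (a + b)) *\<^sub>R x"
        using ab by (simp add: P_def Q_def algebra_simps)
      then show "z \<in> affine hull {p, q}" using 1 by (auto simp: affine_hull_2)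
    qed
  qed
  have "closed_half_plane (affine hull {p, q}) {y. f y \<le> f x - 1}"
    unfolding closed_half_plane_def using f hull by (intro exI[of _ f] exI[of _ "f x - 1"]) auto
  moreover have "wedge_arc x p q \<subseteq> {y. f y \<le> f x - 1}"
  proof
    fix z assume "z \<in> wedge_arc x p q"
    then obtain a b where z: "norm (z - x) = 1" "0 \<le> a" "0 \<le> b" "z - x = a *\<^sub>R P + b *\<^sub>R Q"
      unfolding P_def Q_def by (rule wedge_arcE) blast
    have "1 \<le> a + b" using norm_comb2_le[of a b P 1 Q 1] z p q by (simp add: P_def Q_def)
    then show "z \<in> {y. f y \<le> f x - 1}" using fx[OF z(4)] by simp
  qed
  moreover have "x \<notin> {y. f y \<le> f x - 1}" by simp
  ultimately show ?thesis
    unfolding minimal_arc_of_ball_def using circular_arc_wedge_arc[OF p q pq op] by blast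
qed

text \<open>
  Arcs lie between their endpoints even if the circle contains a longer segment of the line through
  them: leaving the wedge, an injective path would have to revisit its start.
\<close>

lemma arc_coordinate_nonneg:
  fixes g :: "real \<Rightarrow> 'a::real_normed_vector" and b :: "'a \<Rightarrow> real"
  assumes g: "arc g" and b: "continuous_on (path_image g) b" "0 < b (pathfinish g)"
    and start: "\<And>z. z \<in> path_image g \<Longrightarrow> b z = 0 \<Longrightarrow> z = pathstart g"
    and z: "z \<in> path_image g" and b0: "b (pathstart g) = 0"
  shows "0 \<le> b z"
proof (rule ccontr)
  assume neg: "\<not> ?thesis"
  obtain s where s: "0 \<le> s" "s \<le> 1" "z = g s" using z by (auto simp: path_image_def)
  have "continuous_on {0..1} (\<lambda>t. b (g t))"
    by (rule continuous_on_compose2[OF b(1)]) (use g in \<open>auto simp: arc_def path_def path_image_def\<close>)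
  then have "continuous_on {s..1} (\<lambda>t. b (g t))"
    by (rule continuous_on_subset) (use s in auto)
  then obtain t where t: "s \<le> t" "t \<le> 1" "b (g t) = 0"
    using IVT'[of "\<lambda>t. b (g t)" s 0 1] neg s b(2) by (auto simp: pathfinish_def)
  then have "g t = g 0" using start[of "g t"] s by (auto simp: path_image_def pathstart_def)
  moreover have "inj_on g {0..1}" using g by (simp add: arc_def)
  ultimately have "t = 0" using s t by (auto dest: inj_onD)
  then have "z = pathstart g" using s t by (simp add: pathstart_def)
  then show False using neg b0 by simp
qed

text \<open>The half-plane makes the coordinates a, b of z - x with respect to p - x and q - x
  satisfy a + b \<ge> 1 on the arc. A point with b = 0 then has a \<ge> 1, and norm 1 leaves only p;
  so \<open>arc_coordinate_nonneg\<close> yields b \<ge> 0, and the reversed path yields a \<ge> 0.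
  Distance less than 2 rules out the half-circles between opposite endpoints.\<close>

lemma minimal_arc_of_ball_subset_wedge_arc:
  fixes x :: "'a::real_normed_vector"
  assumes dim: "dim (UNIV :: 'a set) = 2" and A: "minimal_arc_of_ball x p q A"
    and pq: "p \<noteq> q" "norm (p - q) < 2"
  shows "A \<subseteq> wedge_arc x p q" "norm (p - x) = 1" "norm (q - x) = 1"
proof -
  obtain g where g: "arc g" "path_image g = A" "pathstart g = p" "pathfinish g = q"
    and Asph: "A \<subseteq> sphere x 1"
    using A by (auto simp: minimal_arc_of_ball_def circular_arc_def)
  obtain f c where f: "linear f" "affine hull {p, q} = {y. f y = (c::real)}" "A \<subseteq> {y. f y \<le> c}"
    and x: "\<not> f x \<le> c \<or> x = midpoint p q"
    using A by (auto simp: minimal_arc_of_ball_def closed_half_plane_def)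
  have "p \<in> A" "q \<in> A" using g by auto
  then show p: "norm (p - x) = 1" and q: "norm (q - x) = 1"
    using Asph by (auto simp: dist_norm norm_minus_commute)
  have op: "p - x \<noteq> - (q - x)" using p pq by (intro not_antipodal) auto
  have "x \<noteq> midpoint p q"
  proof
    assume "x = midpoint p q"
    then have "p + q = 2 *\<^sub>R x" by (simp add: midpoint_def)
    then show False using op by (simp add: algebra_simps scaleR_2)
  qed
  then have fx: "c < f x" using x by simp
  have fp: "f p = c" "f q = c" using f(2) hull_inc[of p "{p, q}" affine] hull_inc[of q "{p, q}" affine] by auto
  define P where "P = p - x"
  define Q where "Q = q - x"
  have *: "a = 0 \<and> b = 0" if "a *\<^sub>R P + b *\<^sub>R Q = 0" for a b
    using unit_vectors_independent[of P Q a b] that p q pq op by (simp add: P_def Q_def)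
  note ind = independent_pairI[OF *]
  have sum: "1 \<le> a + b" if "z \<in> A" "z - x = a *\<^sub>R P + b *\<^sub>R Q" for z a b
  proof -
    have "f z - f x = f (a *\<^sub>R P + b *\<^sub>R Q)" using that f(1) by (metis linear_diff)
    also have "\<dots> = (a + b) * (c - f x)"
      using f(1) fp by (simp add: P_def Q_def linear_add linear_scale linear_diff algebra_simps)
    finally have "(a + b) * (c - f x) \<le> 1 * (c - f x)" using that(1) f(3) by auto
    then show ?thesis using fx by (simp add: mult_le_cancel_right)
  qed
  define f1 where "f1 = (\<lambda>y. if y = P then 1 else (0::real))"
  define f2 where "f2 = (\<lambda>y. if y = Q then 1 else (0::real))"
  obtain a :: "'a \<Rightarrow> real" where a: "linear a" "\<forall>y\<in>{P, Q}. a y = f1 y"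
    using linear_independent_extend[OF ind(2), where f = f1] by blast
  obtain b :: "'a \<Rightarrow> real" where b: "linear b" "\<forall>y\<in>{P, Q}. b y = f2 y"
    using linear_independent_extend[OF ind(2), where f = f2] by blast
  from a b have ab: "linear a" "a P = 1" "a Q = 0" "linear b" "b P = 0" "b Q = 1"
    using ind(1) by (auto simp: f1_def f2_def)
  have dec: "y = a y *\<^sub>R P + b y *\<^sub>R Q" for y
  proof -
    obtain k l where "y = k *\<^sub>R P + l *\<^sub>R Q" by (rule plane_span_pair[OF dim ind])
    moreover from this have "a y = k" "b y = l" using ab by (simp_all add: linear_add linear_scale)
    ultimately show ?thesis by simp
  qed
  have cont: "continuous_on S (\<lambda>z. l (z - x))" if "linear l" for S and l :: "'a \<Rightarrow> real"
    by (rule continuous_on_compose2[OF linear_continuous_on[OF plane_linear_bounded[OF dim that]]])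
      (auto intro!: continuous_intros)
  have nrm: "norm (z - x) = 1" if "z \<in> A" for z
    using Asph that by (auto simp: dist_norm norm_minus_commute)
  have beta: "0 \<le> b (z - x)" if z: "z \<in> A" for z
  proof (rule arc_coordinate_nonneg[OF g(1), where b = "\<lambda>z. b (z - x)"])
    fix z assume "z \<in> path_image g" and 0: "b (z - x) = 0"
    then have z: "z \<in> A" using g by simp
    have "1 \<le> a (z - x)" using sum[OF z dec] 0 by simp
    moreover have eq: "z - x = a (z - x) *\<^sub>R P" using dec[of "z - x"] 0 by simp
    then have "norm (z - x) = \<bar>a (z - x)\<bar> * norm P" by (metis norm_scaleR)
    ultimately have "a (z - x) = 1" using nrm[OF z] p by (simp add: P_def)
    then show "z = pathstart g" using eq g(3) by (simp add: P_def)
  next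
    show "continuous_on (path_image g) (\<lambda>z. b (z - x))" by (rule cont[OF ab(4)])
    show "0 < b (pathfinish g - x)" unfolding g(4) Q_def[symmetric] using ab by simp
    show "z \<in> path_image g" using z g by simp
    show "b (pathstart g - x) = 0" unfolding g(3) P_def[symmetric] using ab by simp
  qed
  have alpha: "0 \<le> a (z - x)" if z: "z \<in> A" for z
  proof (rule arc_coordinate_nonneg[of "reversepath g" "\<lambda>z. a (z - x)"])
    fix z assume "z \<in> path_image (reversepath g)" and 0: "a (z - x) = 0"
    then have z: "z \<in> A" using g by simp
    have "1 \<le> b (z - x)" using sum[OF z dec] 0 by simp
    moreover have eq: "z - x = b (z - x) *\<^sub>R Q" using dec[of "z - x"] 0 by simp
    then have "norm (z - x) = \<bar>b (z - x)\<bar> * norm Q" by (metis norm_scaleR)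
    ultimately have "b (z - x) = 1" using nrm[OF z] q by (simp add: Q_def)
    then show "z = pathstart (reversepath g)" using eq g(4) by (simp add: Q_def)
  next
    show "arc (reversepath g)" using g by (simp add: arc_reversepath)
    show "continuous_on (path_image (reversepath g)) (\<lambda>z. a (z - x))" by (rule cont[OF ab(1)])
    show "0 < a (pathfinish (reversepath g) - x)"
      unfolding pathfinish_reversepath g(3) P_def[symmetric] using ab by simp
    show "z \<in> path_image (reversepath g)" using z g by simp
    show "a (pathstart (reversepath g) - x) = 0"
      unfolding pathstart_reversepath g(4) Q_def[symmetric] using ab by simp
  qed
  show "A \<subseteq> wedge_arc x p q"
  proof
    fix z assume z: "z \<in> A"
    then show "z \<in> wedge_arc x p q"
      using nrm alpha beta dec[of "z - x"] unfolding P_def Q_def by (intro wedge_arcI) auto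
  qed
qed

lemma wedge_arc_subset_cball:
  fixes x :: "'a::real_normed_vector"
  assumes dim: "dim (UNIV :: 'a set) = 2"
    and p: "norm (p - x) = 1" and q: "norm (q - x) = 1" and pq: "p \<noteq> q" "norm (p - q) \<le> 1"
    and y: "p \<in> cball y 1" "q \<in> cball y 1"
  shows "wedge_arc x p q \<subseteq> cball y 1"
proof
  fix z assume "z \<in> wedge_arc x p q"
  then obtain a b where z: "norm (z - x) = 1" "0 \<le> a" "0 \<le> b" "z - x = a *\<^sub>R (p - x) + b *\<^sub>R (q - x)"
    by (rule wedge_arcE)
  have op: "p - x \<noteq> - (q - x)" using p pq by (intro not_antipodal) auto
  have "k = 0 \<and> l = 0" if "k *\<^sub>R (p - x) + l *\<^sub>R (q - x) = 0" for k l
    using unit_vectors_independent[of "p - x" "q - x" k l] that p q pq op by simp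
  from plane_span_pair[OF dim independent_pairI[OF this]]
  obtain c d where cd: "y - x = c *\<^sub>R (p - x) + d *\<^sub>R (q - x)" by metis
  have "norm ((z - x) - (y - x)) \<le> 1" unfolding z(4) cd
  proof (rule wedge_point_in_ball[OF p q])
    show "norm (p - x - (c *\<^sub>R (p - x) + d *\<^sub>R (q - x))) \<le> 1"
      using y unfolding cd[symmetric] by (simp add: dist_norm norm_minus_commute)
    show "norm (q - x - (c *\<^sub>R (p - x) + d *\<^sub>R (q - x))) \<le> 1"
      using y unfolding cd[symmetric] by (simp add: dist_norm norm_minus_commute)
  qed (use z pq in auto)
  then show "z \<in> cball y 1" by (simp add: dist_norm norm_minus_commute)
qed

text \<open>The union is a continuous image of a closed set of triples of a center and two
  coefficients. The coefficients are at most 1 by monotonicity of the norm in the cone, so the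
  triples range over a compact set.\<close>

lemma compact_wedge_arcs:
  fixes p q :: "'a::real_normed_vector"
  assumes dim: "dim (UNIV :: 'a set) = 2" and pq: "norm (p - q) \<le> 1"
  shows "compact (\<Union>x\<in>sphere p 1 \<inter> sphere q 1. wedge_arc x p q)"
proof -
  define w where "w = (\<lambda>(x, \<alpha>, \<beta>). \<alpha> *\<^sub>R (p - x) + \<beta> *\<^sub>R (q - x))"
  have cont: "continuous_on S w" for S unfolding w_def case_prod_beta by (intro continuous_intros)
  define S where "S = ((sphere p 1 \<inter> sphere q 1) \<times> {0..1} \<times> {0..1}) \<inter> {t. norm (w t) = 1}"
  have "closed {t. norm (w t) = 1}" by (intro closed_Collect_eq continuous_on_norm cont continuous_intros)
  then have "compact S" unfolding S_def
    by (intro compact_Int_closed compact_Times compact_Int plane_compact_sphere dim) auto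
  then have "compact ((\<lambda>t. fst t + w t) ` S)"
    by (intro compact_continuous_image continuous_intros cont)
  also have "(\<lambda>t. fst t + w t) ` S = (\<Union>x\<in>sphere p 1 \<inter> sphere q 1. wedge_arc x p q)"
  proof
    show "(\<lambda>t. fst t + w t) ` S \<subseteq> (\<Union>x\<in>sphere p 1 \<inter> sphere q 1. wedge_arc x p q)"
    proof clarify
      fix x a b assume "(x, a, b) \<in> S"
      then have "x \<in> sphere p 1 \<inter> sphere q 1" "fst (x, a, b) + w (x, a, b) \<in> wedge_arc x p q"
        by (auto simp: S_def w_def intro!: wedge_arcI[of _ x a b])
      then show "fst (x, a, b) + w (x, a, b) \<in> (\<Union>x\<in>sphere p 1 \<inter> sphere q 1. wedge_arc x p q)" by blast
    qed
    show "(\<Union>x\<in>sphere p 1 \<inter> sphere q 1. wedge_arc x p q) \<subseteq> (\<lambda>t. fst t + w t) ` S"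
    proof
      fix z assume "z \<in> (\<Union>x\<in>sphere p 1 \<inter> sphere q 1. wedge_arc x p q)"
      then obtain x where x: "x \<in> sphere p 1" "x \<in> sphere q 1" "z \<in> wedge_arc x p q" by auto
      have n: "norm (p - x) = 1" "norm (q - x) = 1" "norm ((p - x) - (q - x)) \<le> 1"
        using x pq by (auto simp: dist_norm)
      from x(3) obtain a b where z: "norm (z - x) = 1" "0 \<le> a" "0 \<le> b"
        "z - x = a *\<^sub>R (p - x) + b *\<^sub>R (q - x)" by (rule wedge_arcE)
      have "a \<le> 1" using norm_cone_mono[OF n, of a a 0 b] z n by simp
      moreover have "b \<le> 1" using norm_cone_mono[OF n, of 0 a b b] z n by simp
      ultimately have "(x, a, b) \<in> S" using x z by (simp add: S_def w_def)
      moreover have "z = fst (x, a, b) + w (x, a, b)" using z(4) by (simp add: w_def algebra_simps)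
      ultimately show "z \<in> (\<lambda>t. fst t + w t) ` S" by (rule rev_image_eqI)
    qed
  qed
  finally show ?thesis .
qed

subsection \<open>Ball hulls\<close>

text \<open>
  If all points of a finite set on the unit circle lie on the same side of the maximizer \<open>e\<close> of a
  functional with kernel direction \<open>k\<close>, the unit ball can be moved downwards (while sliding it
  sideways) without losing them.
\<close>

lemma one_sided_shift:
  fixes e k :: "'a::real_normed_vector"
  assumes K: "finite K" and e: "norm e = 1"
    and *: "\<And>p. p \<in> K \<Longrightarrow> norm p < 1 \<or>
      norm p = 1 \<and> (\<exists>a \<tau>. p = a *\<^sub>R e + \<tau> *\<^sub>R k \<and> 0 \<le> a \<and> a < 1 \<and> 0 < \<tau>)"
  shows "\<exists>\<epsilon>>0. \<exists>\<eta>>0. \<forall>p\<in>K. norm (p - \<epsilon> *\<^sub>R (k - \<eta> *\<^sub>R e)) \<le> 1"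
proof -
  have pos: "\<forall>\<^sub>F t :: real in at_right 0. 0 < t" by (rule eventually_at_right_less)
  \<comment> \<open>The slope \<eta> is chosen before the step \<epsilon>, whose admissible range
    may depend on it; finiteness of K makes both choices uniform.\<close>
  have "\<forall>\<^sub>F \<eta> in at_right 0. \<forall>\<^sub>F \<epsilon> in at_right 0. norm (p - \<epsilon> *\<^sub>R (k - \<eta> *\<^sub>R e)) \<le> 1" if p: "p \<in> K" for p
  proof (cases "norm p < 1")
    case True
    have "\<forall>\<^sub>F \<epsilon> in at_right 0. norm (p - \<epsilon> *\<^sub>R (k - \<eta> *\<^sub>R e)) \<le> 1" for \<eta>
    proof -
      have "((\<lambda>\<epsilon>. norm (p - \<epsilon> *\<^sub>R (k - \<eta> *\<^sub>R e))) \<longlongrightarrow> norm (p - 0 *\<^sub>R (k - \<eta> *\<^sub>R e))) (at_right 0)"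
        by (intro tendsto_intros)
      from order_tendstoD(2)[OF this, of 1] True show ?thesis
        by (auto elim: eventually_mono)
    qed
    then show ?thesis by simp
  next
    case False
    then obtain a \<tau> where a: "norm p = 1" "p = a *\<^sub>R e + \<tau> *\<^sub>R k" "0 \<le> a" "a < 1" "0 < \<tau>"
      using *[OF p] by auto
    have "\<forall>\<^sub>F \<eta> in at_right 0. 0 < \<eta> \<and> \<eta> < (1 - a) / \<tau>"
      using a by (auto simp: eventually_at_right[of 0 1] intro!: exI[of _ "(1 - a) / \<tau>"])
    then show ?thesis
    proof (rule eventually_mono)
      fix \<eta> assume \<eta>: "0 < \<eta> \<and> \<eta> < (1 - a) / \<tau>"
      have "\<forall>\<^sub>F \<epsilon> in at_right 0. 0 < \<epsilon> \<and> \<epsilon> < \<tau>"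
        using a by (auto simp: eventually_at_right[of 0 1] intro!: exI[of _ \<tau>])
      then show "\<forall>\<^sub>F \<epsilon> in at_right 0. norm (p - \<epsilon> *\<^sub>R (k - \<eta> *\<^sub>R e)) \<le> 1"
      proof (rule eventually_mono)
        fix \<epsilon> assume \<epsilon>: "0 < \<epsilon> \<and> \<epsilon> < \<tau>"
        define r where "r = \<epsilon> / \<tau>"
        have r: "0 < r" "r < 1" "\<epsilon> = r * \<tau>" using \<epsilon> a by (auto simp: r_def)
        \<comment> \<open>The sideways shift moves p towards a e, and the remaining gap 1 - a
          absorbs the lift \<tau> \<eta>; the shifted point is a convex combination of p and a
          multiple of e in the unit ball.\<close>
        have "p - \<epsilon> *\<^sub>R (k - \<eta> *\<^sub>R e) = (1 - r) *\<^sub>R p + r *\<^sub>R ((a + \<tau> * \<eta>) *\<^sub>R e)"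
          using a(2) r(3) by (simp add: algebra_simps)
        moreover have "norm ((1 - r) *\<^sub>R p + r *\<^sub>R ((a + \<tau> * \<eta>) *\<^sub>R e)) \<le> (1 - r) * 1 + r * 1"
        proof (rule norm_comb2_le)
          have "\<tau> * \<eta> \<le> 1 - a" using \<eta> a by (simp add: field_simps)
          moreover have "0 \<le> a + \<tau> * \<eta>" using \<eta> a by simp
          ultimately show "norm ((a + \<tau> * \<eta>) *\<^sub>R e) \<le> 1" using e by simp
        qed (use r a in auto)
        ultimately show "norm (p - \<epsilon> *\<^sub>R (k - \<eta> *\<^sub>R e)) \<le> 1" by simp
      qed
    qed
  qed
  then have "\<forall>\<^sub>F \<eta> in at_right 0. \<forall>p\<in>K. \<forall>\<^sub>F \<epsilon> in at_right 0. norm (p - \<epsilon> *\<^sub>R (k - \<eta> *\<^sub>R e)) \<le> 1"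
    by (intro eventually_ball_finite K) auto
  from eventually_happens[OF eventually_conj[OF this pos]]
  obtain \<eta> where \<eta>: "\<forall>p\<in>K. \<forall>\<^sub>F \<epsilon> in at_right 0. norm (p - \<epsilon> *\<^sub>R (k - \<eta> *\<^sub>R e)) \<le> 1" "0 < \<eta>" by auto
  from \<eta>(1) have "\<forall>\<^sub>F \<epsilon> in at_right 0. \<forall>p\<in>K. norm (p - \<epsilon> *\<^sub>R (k - \<eta> *\<^sub>R e)) \<le> 1"
    by (intro eventually_ball_finite K) auto
  from eventually_happens[OF eventually_conj[OF this pos]]
  obtain \<epsilon> where "\<forall>p\<in>K. norm (p - \<epsilon> *\<^sub>R (k - \<eta> *\<^sub>R e)) \<le> 1" "0 < \<epsilon>" by auto
  then show ?thesis using \<eta>(2) by blast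
qed

lemma compact_centers:
  fixes K :: "'a::real_normed_vector set"
  assumes dim: "dim (UNIV :: 'a set) = 2" and "K \<noteq> {}"
  shows "compact {x. K \<subseteq> cball x 1}"
proof (rule plane_compact[OF dim])
  have eq: "{x. K \<subseteq> cball x 1} = (\<Inter>p\<in>K. cball p 1)"
    by (auto simp: dist_commute subset_eq)
  show "closed {x. K \<subseteq> cball x 1}" unfolding eq by auto
  obtain p where "p \<in> K" using assms(2) by auto
  then show "bounded {x. K \<subseteq> cball x 1}"
    unfolding eq by (intro bounded_subset[OF bounded_cball[of p 1]]) auto
qed

text \<open>The set K itself accounts for the degenerate arcs with equal endpoints.\<close>

definition wedge_arcs :: "'a::real_normed_vector set \<Rightarrow> 'a set" where
  "wedge_arcs K = K \<union> (\<Union>p\<in>K. \<Union>q\<in>K - {p}. \<Union>x\<in>sphere p 1 \<inter> sphere q 1. wedge_arc x p q)"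

lemma wedge_arcsI:
  assumes "p \<in> K" "q \<in> K" "p \<noteq> q" "norm (p - x) = 1" "norm (q - x) = 1" "z \<in> wedge_arc x p q"
  shows "z \<in> wedge_arcs K"
proof -
  have "q \<in> K - {p}" "x \<in> sphere p 1 \<inter> sphere q 1" using assms by (auto simp: dist_norm)
  then show ?thesis unfolding wedge_arcs_def using assms(1,6) by blast
qed

lemma wedge_arcsE:
  assumes "z \<in> wedge_arcs K"
  obtains "z \<in> K"
    | p q x where "p \<in> K" "q \<in> K" "p \<noteq> q" "norm (p - x) = 1" "norm (q - x) = 1" "z \<in> wedge_arc x p q"
proof (cases "z \<in> K")
  case False
  then obtain p q x where "p \<in> K" "q \<in> K - {p}" "x \<in> sphere p 1 \<inter> sphere q 1" "z \<in> wedge_arc x p q"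
    using assms unfolding wedge_arcs_def by blast
  then show thesis using that(2)[of p q x] by (auto simp: dist_norm)
qed (rule that(1))

lemma wedge_arcs_attain_support:
  fixes K :: "'a::real_normed_vector set" and f :: "'a \<Rightarrow> real"
  assumes dim: "dim (UNIV :: 'a set) = 2" and K: "finite K" "K \<noteq> {}"
    and diam: "\<And>p q. p \<in> K \<Longrightarrow> q \<in> K \<Longrightarrow> norm (p - q) \<le> 1"
    and f: "linear f" and w: "f w \<noteq> 0"
  shows "\<exists>t\<in>wedge_arcs K. \<forall>v\<in>ball_hull K. f v \<le> f t"
proof -
  obtain e where e: "norm e = 1" "0 < f e" "\<And>y. f y \<le> f e * norm y"
    by (rule plane_unit_ball_maximizer[OF dim f w]) blast
  obtain k where k: "k \<noteq> 0" "f k = 0" "\<And>y. \<exists>\<tau>. y = (f y / f e) *\<^sub>R e + \<tau> *\<^sub>R k"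
    using e(2) by (metis plane_kernel_vector[OF dim f] less_irrefl)
  define C where "C = {x. K \<subseteq> cball x 1}"
  \<comment> \<open>Diameter 1 makes each point of K an admissible center, so minimality of x will
    place K in the half-plane above f x.\<close>
  have KC: "K \<subseteq> C" using diam by (auto simp: C_def dist_norm)
  have "compact C" unfolding C_def by (rule compact_centers[OF dim K(2)])
  moreover have "C \<noteq> {}" using KC K(2) by auto
  moreover have "continuous_on C f"
    by (intro linear_continuous_on plane_linear_bounded dim f)
  ultimately obtain x where x: "x \<in> C" "\<And>y. y \<in> C \<Longrightarrow> f x \<le> f y"
    using continuous_attains_inf[of C f] by blast
  have le1: "norm (p - x) \<le> 1" if "p \<in> K" for p
    using x(1) that by (auto simp: C_def dist_norm norm_minus_commute)
  have upper: "f v \<le> f x + f e" if "v \<in> ball_hull K" for v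
  proof -
    have "norm (v - x) \<le> 1"
      using that x(1) unfolding ball_hull_def C_def by (force simp: dist_norm norm_minus_commute)
    then have "f e * norm (v - x) \<le> f e * 1" using e(2) by (intro mult_left_mono) auto
    then show ?thesis using e(3)[of "v - x"] f by (simp add: linear_diff)
  qed
  show ?thesis
  proof (cases "\<exists>p\<in>K. f (p - x) = f e")
    case True
    then obtain p where p: "p \<in> K" "f p = f x + f e" using f by (auto simp: linear_diff)
    then show ?thesis using upper by (intro bexI[of _ p]) (auto simp: wedge_arcs_def)
  next
    case False
    have boundary: "\<exists>a \<tau>. p - x = a *\<^sub>R e + \<tau> *\<^sub>R k \<and> 0 \<le> a \<and> a < 1 \<and> \<tau> \<noteq> 0"
      if p: "p \<in> K" "norm (p - x) = 1" for p
    proof -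
      obtain \<tau> where \<tau>: "p - x = (f (p - x) / f e) *\<^sub>R e + \<tau> *\<^sub>R k" using k(3) by blast
      have "f x \<le> f p" using KC p x by auto
      then have "0 \<le> f (p - x)" using f by (simp add: linear_diff)
      moreover have "f (p - x) < f e" using e(3)[of "p - x"] p False by force
      ultimately have a: "0 \<le> f (p - x) / f e" "f (p - x) / f e < 1" using e(2) by auto
      have "\<tau> \<noteq> 0"
      proof
        assume "\<tau> = 0"
        then have "norm (p - x) = norm ((f (p - x) / f e) *\<^sub>R e)" using \<tau> by simp
        also have "\<dots> = f (p - x) / f e"
          using a(1) e(1) by (metis abs_of_nonneg mult.right_neutral norm_scaleR)
        finally show False using p(2) a(2) by simp
      qed
      then show ?thesis using \<tau> a by blast
    qed
    \<comment> \<open>Both signs of \<sigma> are used, one for each side of x + e. If one side had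
      no boundary point, \<open>one_sided_shift\<close> would produce an admissible center lower
      than x.\<close>
    have side: "\<exists>p\<in>K. norm (p - x) = 1 \<and> (\<exists>a \<tau>. p - x = a *\<^sub>R e + \<tau> *\<^sub>R k \<and> 0 \<le> a \<and> a < 1 \<and> \<sigma> * \<tau> < 0)"
      if \<sigma>: "\<sigma> = 1 \<or> \<sigma> = - 1" for \<sigma>
    proof (rule ccontr)
      assume none: "\<not> ?thesis"
      have *: "norm u < 1 \<or> norm u = 1 \<and>
          (\<exists>a \<tau>. u = a *\<^sub>R e + \<tau> *\<^sub>R (\<sigma> *\<^sub>R k) \<and> 0 \<le> a \<and> a < 1 \<and> 0 < \<tau>)"
        if u: "u \<in> (\<lambda>p. p - x) ` K" for u
      proof -
        obtain p where p: "p \<in> K" "u = p - x" using u by auto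
        show ?thesis
        proof (cases "norm (p - x) = 1")
          case True
          then obtain a \<tau> where a: "p - x = a *\<^sub>R e + \<tau> *\<^sub>R k" "0 \<le> a" "a < 1" "\<tau> \<noteq> 0"
            using boundary p by blast
          then have "0 < \<sigma> * \<tau>" using none p True \<sigma> by force
          moreover have "\<tau> *\<^sub>R k = (\<sigma> * \<tau>) *\<^sub>R (\<sigma> *\<^sub>R k)" using \<sigma> by auto
          ultimately show ?thesis using a True p(2) by metis
        next
          case False
          then show ?thesis using le1[OF p(1)] p(2) by simp
        qed
      qed
      obtain \<epsilon> \<eta> where \<epsilon>: "0 < \<epsilon>" "0 < \<eta>"
        "\<forall>u\<in>(\<lambda>p. p - x) ` K. norm (u - \<epsilon> *\<^sub>R (\<sigma> *\<^sub>R k - \<eta> *\<^sub>R e)) \<le> 1"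
        using one_sided_shift[OF finite_imageI[OF K(1)] e(1) *] by blast
      define y where "y = x + \<epsilon> *\<^sub>R (\<sigma> *\<^sub>R k - \<eta> *\<^sub>R e)"
      have "norm (p - y) \<le> 1" if "p \<in> K" for p
        using \<epsilon>(3) that by (auto simp: y_def algebra_simps)
      then have "y \<in> C" by (auto simp: C_def dist_norm norm_minus_commute)
      then have "f x \<le> f y" by (rule x(2))
      also have "f y = f x - \<epsilon> * \<eta> * f e"
        using f k(2) by (simp add: y_def linear_add linear_diff linear_scale)
      finally have "\<epsilon> * \<eta> * f e \<le> 0" by simp
      moreover have "0 < \<epsilon> * \<eta> * f e" using \<epsilon>(1,2) e(2) by (intro mult_pos_pos)
      ultimately show False by simp
    qed
    obtain p a \<tau> where p: "p \<in> K" "norm (p - x) = 1" "p - x = a *\<^sub>R e + \<tau> *\<^sub>R k" "0 \<le> a" "\<tau> < 0"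
      using side[of 1] by auto
    obtain q b \<theta> where q: "q \<in> K" "norm (q - x) = 1" "q - x = b *\<^sub>R e + \<theta> *\<^sub>R k" "0 \<le> b" "0 < \<theta>"
      using side[of "- 1"] by auto
    \<comment> \<open>Eliminating k shows that a nonnegative multiple of e lies in the cone of p - x
      and q - x.\<close>
    have comb: "\<theta> *\<^sub>R (p - x) + (- \<tau>) *\<^sub>R (q - x) = (\<theta> * a - \<tau> * b) *\<^sub>R e"
      unfolding p(3) q(3) by (simp add: algebra_simps)
    have nn: "0 \<le> \<theta> * a" "\<tau> * b \<le> 0"
      using p(4,5) q(4,5) by (auto intro: mult_nonneg_nonneg mult_nonpos_nonneg)
    \<comment> \<open>If the multiple were zero, p - x and q - x would be opposite unit multiples of
      k, giving p and q distance 2.\<close>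
    have "\<theta> * a - \<tau> * b \<noteq> 0"
    proof
      assume 0: "\<theta> * a - \<tau> * b = 0"
      have "\<theta> * a = 0" "\<tau> * b = 0" using 0 nn by linarith+
      then have "a = 0" "b = 0" using p(5) q(5) by auto
      then have "norm (p - x) = \<bar>\<tau>\<bar> * norm k" "norm (q - x) = \<bar>\<theta>\<bar> * norm k"
        using p(3) q(3) by simp_all
      then have "\<bar>\<tau>\<bar> * norm k + \<bar>\<theta>\<bar> * norm k = 2" using p(2) q(2) by simp
      moreover have "p - q = (\<tau> - \<theta>) *\<^sub>R k"
        using p(3) q(3) \<open>a = 0\<close> \<open>b = 0\<close> by (simp add: algebra_simps)
      then have "norm (p - q) = (\<bar>\<tau>\<bar> + \<bar>\<theta>\<bar>) * norm k" using p(5) q(5) by simp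
      ultimately show False using diam[OF p(1) q(1)] by (simp add: algebra_simps)
    qed
    then have c: "0 < \<theta> * a - \<tau> * b" using nn by linarith
    define c where "c = \<theta> * a - \<tau> * b"
    have "x + e \<in> wedge_arc x p q"
    proof (rule wedge_arcI)
      have "e = (1 / c) *\<^sub>R (c *\<^sub>R e)" using c by (simp add: c_def)
      also have "c *\<^sub>R e = \<theta> *\<^sub>R (p - x) + (- \<tau>) *\<^sub>R (q - x)" unfolding c_def by (rule comb[symmetric])
      finally show "x + e - x = (\<theta> / c) *\<^sub>R (p - x) + (- \<tau> / c) *\<^sub>R (q - x)"
        by (simp add: scaleR_add_right scaleR_diff_right)
    qed (use e p q c in \<open>auto simp: c_def divide_nonpos_pos\<close>)
    moreover have "p \<noteq> q"
    proof
      assume "p = q"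
      then have 1: "(a - b) *\<^sub>R e + (\<tau> - \<theta>) *\<^sub>R k = 0" using p(3) q(3) by (simp add: algebra_simps)
      have "f ((a - b) *\<^sub>R e + (\<tau> - \<theta>) *\<^sub>R k) = (a - b) * f e" using f k(2) by (simp add: linear_add linear_scale)
      then have "a = b" using 1 e(2) f by (simp add: linear_0)
      then show False using 1 k(1) p(5) q(5) by simp
    qed
    ultimately have "x + e \<in> wedge_arcs K" using p q by (intro wedge_arcsI[of p K q x]) auto
    then show ?thesis using upper f by (intro bexI[of _ "x + e"]) (auto simp: linear_add)
  qed
qed

section \<open>Reduction to balls with two points of K on their boundary\<close>

lemma flat_side_extreme_point:
  fixes g :: "'a::real_normed_vector \<Rightarrow> real"
  assumes g: "linear g" "g w = 0" and w: "w \<noteq> 0"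
    and u: "norm u = 1" "0 < g u" "\<And>y. g y \<le> g u * norm y"
  shows "\<exists>y. norm y = 1 \<and> g y = g u \<and> 1 < norm (y - w)"
proof (rule ccontr)
  assume "\<not> ?thesis"
  then have none: "norm (y - w) \<le> 1" if "norm y = 1" "g y = g u" for y
    using that by (metis not_le)
  \<comment> \<open>Subtracting w keeps the value of g, hence norm at least 1, while the negated
    claim gives norm at most 1. Repeating this would put arbitrarily long vectors on the unit
    circle.\<close>
  have *: "norm (u - real n *\<^sub>R w) = 1 \<and> g (u - real n *\<^sub>R w) = g u" for n
  proof (induction n)
    case (Suc n)
    have eq: "u - real (Suc n) *\<^sub>R w = (u - real n *\<^sub>R w) - w" by (simp add: algebra_simps)
    have g1: "g (u - real (Suc n) *\<^sub>R w) = g u" using g by (simp add: linear_diff linear_scale)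
    then have "1 \<le> norm (u - real (Suc n) *\<^sub>R w)"
      using u(3)[of "u - real (Suc n) *\<^sub>R w"] u(2) by simp
    moreover have "norm (u - real (Suc n) *\<^sub>R w) \<le> 1" unfolding eq using none Suc by blast
    ultimately show ?case using g1 by simp
  qed (use u in simp)
  obtain n :: nat where n: "2 < real n * norm w"
    using w reals_Archimedean3[of "norm w"] by auto
  have "real n *\<^sub>R w = u - (u - real n *\<^sub>R w)" by simp
  then have "norm (real n *\<^sub>R w) \<le> norm u + norm (u - real n *\<^sub>R w)" by (metis norm_triangle_ineq4)
  then show False using * u(1) n by simp
qed

lemma excluding_vertex_exists:
  fixes K :: "'a::real_normed_vector set"
  assumes dim: "dim (UNIV :: 'a set) = 2" and K: "finite K"
    and diam: "\<And>p q. p \<in> K \<Longrightarrow> q \<in> K \<Longrightarrow> norm (p - q) \<le> 1"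
    and two: "\<And>p. p \<in> K \<Longrightarrow> \<exists>q\<in>K. q \<noteq> p"
    and x0: "K \<subseteq> cball x0 1" "1 < norm (x0 - v)" and ne: "K \<noteq> {}"
  shows "\<exists>x. \<exists>p\<in>K. \<exists>q\<in>K. p \<noteq> q \<and> norm (p - x) = 1 \<and> norm (q - x) = 1 \<and>
    K \<subseteq> cball x 1 \<and> 1 < norm (x - v)"
proof (rule ccontr)
  assume neg: "\<not> ?thesis"
  have none: False if "p \<in> K" "q \<in> K" "p \<noteq> q" "norm (p - x) = 1" "norm (q - x) = 1"
    "K \<subseteq> cball x 1" "1 < norm (x - v)" for x p q
    using neg that by blast
  define C where "C = {x. K \<subseteq> cball x 1}"
  have KC: "K \<subseteq> C" using diam by (auto simp: C_def dist_norm)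
  have "compact C" unfolding C_def by (rule compact_centers[OF dim ne])
  moreover have "C \<noteq> {}" using x0 by (auto simp: C_def)
  moreover have "continuous_on C (\<lambda>x. norm (x - v))" by (intro continuous_intros)
  ultimately obtain x where x: "x \<in> C" "\<And>y. y \<in> C \<Longrightarrow> norm (y - v) \<le> norm (x - v)"
    using continuous_attains_sup[of C "\<lambda>x. norm (x - v)"] by blast
  have xv: "1 < norm (x - v)" using x(2)[of x0] x0 by (simp add: C_def)
  \<comment> \<open>Otherwise x could be pushed a little further away from v and remain an
    admissible center.\<close>
  have "\<exists>p\<in>K. norm (x - p) = 1"
  proof (rule ccontr)
    assume "\<not> ?thesis"
    then have lt: "norm (x - p) < 1" if "p \<in> K" for p
      using that x(1) by (force simp: C_def dist_norm)
    have "\<forall>\<^sub>F \<epsilon> in at_right 0. norm (x + \<epsilon> *\<^sub>R (x - v) - p) \<le> 1" if "p \<in> K" for p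
    proof -
      have "((\<lambda>\<epsilon>. norm (x + \<epsilon> *\<^sub>R (x - v) - p)) \<longlongrightarrow> norm (x + 0 *\<^sub>R (x - v) - p)) (at_right 0)"
        by (intro tendsto_intros)
      from order_tendstoD(2)[OF this, of 1] lt[OF that] show ?thesis
        by (auto elim: eventually_mono)
    qed
    then have "\<forall>\<^sub>F \<epsilon> in at_right 0. \<forall>p\<in>K. norm (x + \<epsilon> *\<^sub>R (x - v) - p) \<le> 1"
      by (intro eventually_ball_finite K) auto
    from eventually_happens[OF eventually_conj[OF this eventually_at_right_less]]
    obtain \<epsilon> where \<epsilon>: "\<forall>p\<in>K. norm (x + \<epsilon> *\<^sub>R (x - v) - p) \<le> 1" "0 < \<epsilon>" by auto
    then have "norm (x + \<epsilon> *\<^sub>R (x - v) - v) \<le> norm (x - v)"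
      by (intro x(2)) (auto simp: C_def dist_norm)
    moreover have "x + \<epsilon> *\<^sub>R (x - v) - v = (1 + \<epsilon>) *\<^sub>R (x - v)" by (simp add: algebra_simps)
    ultimately have "(1 + \<epsilon>) * norm (x - v) \<le> 1 * norm (x - v)" using \<epsilon>(2) by simp
    then show False using xv \<epsilon>(2) by (subst (asm) mult_le_cancel_right) auto
  qed
  then obtain p where p: "p \<in> K" "norm (x - p) = 1" by blast
  \<comment> \<open>From here p is the origin: a center is p + y, the excluded point is p + w, and e
    is the unit vector pointing away from it.\<close>
  define w where "w = v - p"
  have xw: "x - p - w = x - v" by (simp add: w_def)
  have w0: "w \<noteq> 0" using xv p(2) xw by auto
  define s where "s = norm w"
  define e where "e = - (w /\<^sub>R s)"
  have s: "0 < s" using w0 by (simp add: s_def)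
  have e: "norm e = 1" using s by (simp add: e_def s_def)
  have we: "y - w = y + s *\<^sub>R e" for y using s by (simp add: e_def)
  text \<open>
    Without such a vertex, \<open>E \<inter> G\<close> is relatively open and closed in \<open>E\<close>, and \<open>E\<close> is connected because
    all its points can be joined to \<open>e\<close>; so every center on this circle excluding \<open>v\<close> is admissible.
  \<close>
  define E where "E = {y. norm y = 1 \<and> 1 < norm (y - w)}"
  define G where "G = {y. K \<subseteq> cball (p + y) 1}"
  have strict: "norm (p + y - q) < 1" if "y \<in> E" "y \<in> G" "q \<in> K" "q \<noteq> p" for y q
  proof -
    have "norm (q - (p + y)) \<le> 1" using that by (auto simp: G_def dist_norm norm_minus_commute)
    moreover have "norm (q - (p + y)) \<noteq> 1"
      using none[of p q "p + y"] that p(1) by (auto simp: E_def G_def w_def algebra_simps)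
    ultimately show ?thesis by (simp add: norm_minus_commute)
  qed
  have spread: "A \<subseteq> G" if A: "connected A" "A \<subseteq> E" "a \<in> A" "a \<in> G" for A a
  proof -
    define U where "U = (\<Inter>q\<in>K - {p}. {y. norm (p + y - q) < 1})"
    have U: "open U" unfolding U_def using K
      by (intro open_INT ballI open_Collect_less continuous_intros) auto
    have "G = (\<Inter>q\<in>K. {y. norm (p + y - q) \<le> 1})" by (auto simp: G_def dist_norm)
    moreover have "closed (\<Inter>q\<in>K. {y. norm (p + y - q) \<le> 1})"
      by (intro closed_INT ballI closed_Collect_le continuous_intros)
    ultimately have G: "open (- G)" by (simp only: open_Compl)
    have GU: "y \<in> U" if "y \<in> A" "y \<in> G" for y
      using strict[of y] that A(2) by (auto simp: U_def)
    have UG: "y \<in> G" if "y \<in> A" "y \<in> U" for y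
    proof -
      have "norm (p + y - q) \<le> 1" if q: "q \<in> K" for q
      proof (cases "q = p")
        case True
        then show ?thesis using \<open>y \<in> A\<close> A(2) by (auto simp: E_def)
      next
        case False
        then show ?thesis using \<open>y \<in> U\<close> q by (force simp: U_def)
      qed
      then show ?thesis by (auto simp: G_def dist_norm)
    qed
    have "U \<inter> A = {} \<or> - G \<inter> A = {}"
      by (rule connectedD[OF A(1) U G]) (use GU UG in auto)
    then show ?thesis using A GU by auto
  qed
  have eE: "e \<in> E"
  proof -
    have "e - w = (1 + s) *\<^sub>R e" unfolding we by (simp add: algebra_simps)
    then show ?thesis using e s by (simp add: E_def)
  qed
  \<comment> \<open>Joining along the wedge arc to e breaks down at the opposite point - e, which is
    therefore left out; neither x - p nor the extreme points used below coincide with it.\<close>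
  have hub: "\<exists>A. connected A \<and> A \<subseteq> E \<and> y \<in> A \<and> e \<in> A" if y: "y \<in> E" "y \<noteq> - e" for y
  proof (cases "y = e")
    case True
    then show ?thesis using eE by (intro exI[of _ "{e}"]) auto
  next
    case False
    have ny: "norm y = 1" and out: "1 < norm (y + s *\<^sub>R e)" using y by (auto simp: E_def we)
    have "circular_arc 0 y e (wedge_arc 0 y e)"
      using circular_arc_wedge_arc[of y 0 e] ny e False y(2) by simp
    then obtain c where c: "arc c" "path_image c = wedge_arc 0 y e" "pathstart c = y" "pathfinish c = e"
      by (auto simp: circular_arc_def)
    have "wedge_arc 0 y e \<subseteq> E"
    proof
      fix z assume "z \<in> wedge_arc 0 y e"
      then obtain a b where z: "norm (z - 0) = 1" "0 \<le> a" "0 \<le> b"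
        "z - 0 = a *\<^sub>R (y - 0) + b *\<^sub>R (e - 0)" by (rule wedge_arcE)
      then have "1 < norm (a *\<^sub>R y + b *\<^sub>R e + s *\<^sub>R e)"
        by (intro norm_gt_one_towards_apex[OF ny e s out]) auto
      then show "z \<in> E" using z by (simp add: E_def we)
    qed
    moreover have "connected (path_image c)" using c(1) by (simp add: arc_imp_path connected_path_image)
    moreover have "y \<in> path_image c" "e \<in> path_image c" using c by auto
    ultimately show ?thesis using c(2) by metis
  qed
  have xE: "x - p \<in> E" unfolding E_def mem_Collect_eq xw using p(2) xv by simp
  have xG: "x - p \<in> G" using x(1) by (simp add: G_def C_def)
  \<comment> \<open>At - e the distance from x to v would be \<bar>s - 1\<bar>, but the admissible
    center p already has distance s from v. Maximality and the exclusion of v by x then contradict s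
    > 0.\<close>
  have xe: "x - p \<noteq> - e"
  proof
    assume eq: "x - p = - e"
    have "x - v = (s - 1) *\<^sub>R e" using xw[symmetric] unfolding we eq by (simp add: algebra_simps)
    then have 1: "norm (x - v) = \<bar>s - 1\<bar>" using e by simp
    have "norm (p - v) = s" by (simp add: s_def w_def norm_minus_commute)
    then have "s \<le> norm (x - v)" using x(2)[of p] KC p(1) by auto
    then show False using 1 xv s by linarith
  qed
  have eG: "e \<in> G" using hub[OF xE xe] spread xG by blast
  have EG: "y \<in> G" if "y \<in> E" "y \<noteq> - e" for y using hub[OF that] spread eG by blast
  obtain q where q: "q \<in> K" "q \<noteq> p" using two p(1) by blast
  \<comment> \<open>With y a highest point of the unit circle, p is a lowest point of the ball about
    p + y with respect to g. As q is in the interior of that ball, it lies strictly above p;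
    applying this to g and to its negative gives the contradiction.\<close>
  have side: "0 < g (q - p)" if g: "linear g" "g w = 0" and u: "norm u = 1" "0 < g u" "\<And>y. g y \<le> g u * norm y"
    for g :: "'a \<Rightarrow> real" and u
  proof -
    obtain y where y: "norm y = 1" "g y = g u" "1 < norm (y - w)"
      using flat_side_extreme_point[OF g w0 u] by blast
    have "g e = 0" using g by (simp add: e_def linear_neg linear_scale)
    then have "y \<noteq> - e" using y(2) u(2) g(1) by (auto simp: linear_neg)
    moreover have "y \<in> E" using y by (simp add: E_def)
    ultimately have "norm (p + y - q) < 1" using EG strict q by blast
    then have "g u * norm (p + y - q) < g u * 1" using u(2) by (intro mult_strict_left_mono) auto
    then have "g (p + y - q) < g u" using u(3)[of "p + y - q"] by simp
    then show ?thesis using g(1) y(2) by (simp add: linear_add linear_diff)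
  qed
  obtain g :: "'a \<Rightarrow> real" and w' where g: "linear g" "g w = 0" "g w' \<noteq> 0"
    by (rule plane_annihilator[OF dim w0])
  obtain u where u: "norm u = 1" "0 < g u" "\<And>y. g y \<le> g u * norm y"
    by (rule plane_unit_ball_maximizer[OF dim g(1,3)]) blast
  have "0 < g (q - p)" by (rule side[OF g(1,2) u])
  moreover have "0 < - g (q - p)"
  proof (rule side[where u = "- u" and g = "\<lambda>y. - g y"])
    show "linear (\<lambda>y. - g y)" using g(1) by (simp add: linear_compose_neg)
    show "- g y \<le> - g (- u) * norm y" for y using u(3)[of "- y"] g(1) by (simp add: linear_neg)
  qed (use g u in \<open>simp_all add: linear_neg\<close>)
  ultimately show False by simp
qed

section \<open>The two descriptions of the ball hull\<close>

theorem theorem3: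
  fixes K :: "'a::real_normed_vector set"
  assumes "dim (UNIV :: 'a set) = 2"
    and "finite K"
    and "diameter K = 1"
  shows "ball_hull K = \<Inter>{B \<in> arc_balls K. K \<subseteq> B} \<and>
         \<Inter>{B \<in> arc_balls K. K \<subseteq> B} = convex hull (\<Union>{A. \<exists>p\<in>K. \<exists>q\<in>K. minimal_arc p q A})"
proof -
  note dim = assms(1)
  have diam: "norm (p - q) \<le> 1" if "p \<in> K" "q \<in> K" for p q
    using diameter_bounded_bound[OF finite_imp_bounded[OF assms(2)] that] assms(3)
    by (simp add: dist_norm)
  have ne: "K \<noteq> {}" using assms(3) by auto
  have two: "\<exists>q\<in>K. q \<noteq> p" if "p \<in> K" for p
  proof (rule ccontr)
    assume "\<not> ?thesis"
    then have "K = {p}" using that by blast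
    then show False using assms(3) by simp
  qed
  have op: "p - x \<noteq> - (q - x)" if "p \<in> K" "q \<in> K" "norm (p - x) = 1" for p q x
    using that diam[of p q] by (intro not_antipodal) auto
  let ?I = "\<Inter>{B \<in> arc_balls K. K \<subseteq> B}"
  let ?U = "\<Union>{A. \<exists>p\<in>K. \<exists>q\<in>K. minimal_arc p q A}"
  have "ball_hull K \<subseteq> ?I" unfolding ball_hull_def arc_balls_def by blast
  moreover have "?I \<subseteq> ball_hull K"
  proof (rule subsetI, rule ccontr)
    fix v assume v: "v \<in> ?I" "v \<notin> ball_hull K"
    then obtain x0 where x0: "K \<subseteq> cball x0 1" "1 < norm (x0 - v)"
      by (auto simp: ball_hull_def dist_norm)
    obtain x p q where x: "p \<in> K" "q \<in> K" "p \<noteq> q" "norm (p - x) = 1" "norm (q - x) = 1"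
      "K \<subseteq> cball x 1" "1 < norm (x - v)"
      using excluding_vertex_exists[OF dim assms(2) diam two x0 ne] by blast
    have "cball x 1 \<in> arc_balls K"
      unfolding arc_balls_def using x circular_arc_wedge_arc[OF x(4,5,3) op] by blast
    then have "v \<in> cball x 1" using v(1) x(6) by blast
    then show False using x(7) by (simp add: dist_norm)
  qed
  moreover have "ball_hull K \<subseteq> convex hull ?U"
  proof -
    have "wedge_arcs K \<subseteq> ?U"
    proof
      fix z assume "z \<in> wedge_arcs K"
      then consider "z \<in> K" | p q x where "p \<in> K" "q \<in> K" "p \<noteq> q" "norm (p - x) = 1" "norm (q - x) = 1"
        "z \<in> wedge_arc x p q"
        by (rule wedge_arcsE)
      then show "z \<in> ?U"
      proof cases
        case 1
        then have "minimal_arc z z {z}" by (simp add: minimal_arc_def)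
        then show ?thesis using 1 by blast
      next
        case 2
        then have "minimal_arc p q (wedge_arc x p q)"
          using minimal_arc_wedge_arc[OF dim 2(4,5,3) op[OF 2(1,2,4)]] by (auto simp: minimal_arc_def)
        then show ?thesis using 2 by blast
      qed
    qed
    moreover have "ball_hull K \<subseteq> convex hull (wedge_arcs K)"
    proof (rule subsetI, rule ccontr)
      fix v assume v: "v \<in> ball_hull K" "v \<notin> convex hull (wedge_arcs K)"
      \<comment> \<open>Compactness gives a functional strictly larger at v than on all the arcs,
        although its values on the ball hull are bounded by its value at some point of the
        arcs.\<close>
      have "compact (wedge_arcs K)" unfolding wedge_arcs_def
        by (intro compact_Un compact_UN compact_wedge_arcs dim finite_imp_compact finite_Diff assms(2))
          (auto intro: diam)
      then obtain f :: "'a \<Rightarrow> real" where f: "linear f" "\<And>t. t \<in> wedge_arcs K \<Longrightarrow> f t < f v"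
        by (rule plane_separation[OF dim _ v(2)]) blast
      obtain p where p: "p \<in> K" using ne by blast
      have "f p < f v" using f(2) p by (auto simp: wedge_arcs_def)
      then have "f (v - p) \<noteq> 0" using f(1) by (simp add: linear_diff)
      then obtain t where "t \<in> wedge_arcs K" "\<forall>v\<in>ball_hull K. f v \<le> f t"
        using wedge_arcs_attain_support[OF dim assms(2) ne diam f(1)] by blast
      then show False using f(2)[of t] v(1) by force
    qed
    ultimately show ?thesis by (meson hull_mono order_trans)
  qed
  moreover have "convex hull ?U \<subseteq> ball_hull K"
  proof (rule hull_minimal)
    show "convex (ball_hull K)" unfolding ball_hull_def by (intro convex_Inter) auto
    show "?U \<subseteq> ball_hull K"
    proof clarify
      fix z A p q assume pq: "p \<in> K" "q \<in> K" "minimal_arc p q A" "z \<in> A"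
      show "z \<in> ball_hull K"
      proof (cases "p = q")
        case True
        then show ?thesis using pq by (auto simp: minimal_arc_def ball_hull_def)
      next
        case False
        then obtain x where x: "minimal_arc_of_ball x p q A" using pq by (auto simp: minimal_arc_def)
        have "norm (p - q) < 2" using diam[of p q] pq by simp
        note w = minimal_arc_of_ball_subset_wedge_arc[OF dim x False this]
        have "z \<in> cball y 1" if "K \<subseteq> cball y 1" for y
          using wedge_arc_subset_cball[OF dim w(2,3) False diam] that w(1) pq by blast
        then show ?thesis by (auto simp: ball_hull_def)
      qed
    qed
  qed
  ultimately show ?thesis by blast
qed

end
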